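(* Let $r,s>0$, let $P=\mathcal{N}(m;\Sigma)$ be the Gaussian distribution on $\mathbb{R}^d$ with mean $m$ and (positive definite) covariance matrix $\Sigma$, with density $f$. Assume $(\alpha_n)_{n\ge1}$ is asymptotically $L^r(P)$-optimal, and let $\theta^\star=\sqrt{(s+d)/(r+d)}$. Then the sequence $(\alpha_n^{\theta^\star,m})_{n\ge1}$ satisfies the empirical measure theorem (for the exponent $s$); in other words, for every $a,b\in\mathbb{R}^d$, $$\frac1n\,\mathrm{card}\bigl(\alpha_n^{\theta^\star,m}\cap[a,b]\bigr)\;\longrightarrow\;\frac{1}{C_{f,s}}\int_{[a,b]}f(x)^{\frac{d}{d+s}}\,dx\qquad(n\to\infty),$$ where $C_{f,s}=\int_{\mathbb{R}^d}f(x)^{\frac{d}{d+s}}\,dx$.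
   Context: $\lambda_d$ is Lebesgue measure on $\mathbb{R}^d$, $|\cdot|$ is a norm on $\mathbb{R}^d$, and $d(x,\alpha)=\min_{a\in\alpha}|x-a|$ for a finite nonempty $\alpha\subset\mathbb{R}^d$. A sequence of quantizers $(\alpha_n)_{n\ge1}$ is a sequence of finite nonempty sets $\alpha_n\subset\mathbb{R}^d$ with $\mathrm{card}(\alpha_n)\le n$. With $e_{n,r}(P)=\inf_{\mathrm{card}(\alpha)\le n}\left(\int d(x,\alpha)^r dP(x)\right)^{1/r}$, $J_{r,d}=\inf_{n\ge1}n^{r/d}e_{n,r}^r(U([0,1]^d))$ ($U([0,1]^d)$ uniform distribution), and $Q_r(P)=J_{r,d}\left(\int f^{d/(d+r)}d\lambda_d\right)^{(d+r)/d}$, the sequence $(\alpha_n)$ is asymptotically $L^r(P)$-optimal if $\lim_n n^{r/d}\int d(x,\alpha_n)^r dP(x)=Q_r(P)$. $\alpha_n^{\theta,m}=\{m+\theta(a-m):a\in\alpha_n\}$. For $a,b\in\mathbb{R}^d$, $[a,b]=[a_1,b_1]\times\cdots\times[a_d,b_d]$. *)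

theory Defs
  imports "HOL-Probability.Probability"
begin

text \<open>
  The space \<open>\<real>\<^sup>d\<close> is \<^typ>\<open>real ^ 'd\<close>, so \<open>d = CARD('d)\<close>. Quantization errors are measured in an
  arbitrary norm \<open>N\<close>, not necessarily the Euclidean one of the library.
\<close>

definition is_norm :: "(real ^ 'd \<Rightarrow> real) \<Rightarrow> bool" where
  "is_norm N \<longleftrightarrow>
     (\<forall>x. N x \<ge> 0) \<and> (\<forall>x. N x = 0 \<longleftrightarrow> x = 0) \<and>
     (\<forall>c x. N (c *\<^sub>R x) = \<bar>c\<bar> * N x) \<and> (\<forall>x y. N (x + y) \<le> N x + N y)"

definition set_dist :: "(real ^ 'd \<Rightarrow> real) \<Rightarrow> real ^ 'd \<Rightarrow> (real ^ 'd) set \<Rightarrow> real" where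
  "set_dist N x \<alpha> = Min ((\<lambda>a. N (x - a)) ` \<alpha>)"

text \<open>
  The \<open>r\<close>-th power of the \<open>L\<^sup>r(P)\<close>-quantization error induced by \<open>\<alpha>\<close>. The Bochner integral is
  used; it is the intended value only for \<open>P\<close> with a finite \<open>r\<close>-th moment (it would
  be \<open>0\<close> otherwise).
\<close>

definition distortion ::
  "(real ^ 'd \<Rightarrow> real) \<Rightarrow> real \<Rightarrow> (real ^ 'd) measure \<Rightarrow> (real ^ 'd) set \<Rightarrow> real" where
  "distortion N r P \<alpha> = (LINT x|P. set_dist N x \<alpha> powr r)"

definition quant_error ::
  "(real ^ 'd \<Rightarrow> real) \<Rightarrow> real \<Rightarrow> (real ^ 'd) measure \<Rightarrow> nat \<Rightarrow> real" where
  "quant_error N r P n =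
     (INF \<alpha>\<in>{\<alpha>. finite \<alpha> \<and> \<alpha> \<noteq> {} \<and> card \<alpha> \<le> n}. distortion N r P \<alpha> powr (1 / r))"

text \<open>The vector \<open>1\<close> has all coordinates \<open>1\<close>, so \<open>cbox 0 1\<close> is the unit cube.\<close>

definition J_const :: "(real ^ 'd \<Rightarrow> real) \<Rightarrow> real \<Rightarrow> real" where
  "J_const N r =
     (INF n\<in>{1::nat..}. real n powr (r / real CARD('d)) *
        quant_error N r (uniform_measure lborel (cbox (0 :: real ^ 'd) 1)) n powr r)"

text \<open>The constant \<open>Q\<^sub>r(P)\<close> for the distribution \<open>P\<close> with Lebesgue density \<open>f\<close>.\<close>

definition Q_const :: "(real ^ 'd \<Rightarrow> real) \<Rightarrow> real \<Rightarrow> (real ^ 'd \<Rightarrow> real) \<Rightarrow> real" where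
  "Q_const N r f =
     J_const N r *
     (LINT x|lborel. f x powr (real CARD('d) / (real CARD('d) + r)))
       powr ((real CARD('d) + r) / real CARD('d))"

definition quantizer_seq :: "(nat \<Rightarrow> (real ^ 'd) set) \<Rightarrow> bool" where
  "quantizer_seq \<alpha> \<longleftrightarrow> (\<forall>n\<ge>1. finite (\<alpha> n) \<and> \<alpha> n \<noteq> {} \<and> card (\<alpha> n) \<le> n)"

definition asymp_optimal ::
  "(real ^ 'd \<Rightarrow> real) \<Rightarrow> real \<Rightarrow> (real ^ 'd \<Rightarrow> real) \<Rightarrow> (nat \<Rightarrow> (real ^ 'd) set) \<Rightarrow> bool" where
  "asymp_optimal N r f \<alpha> \<longleftrightarrow>
     quantizer_seq \<alpha> \<and>
     (\<lambda>n. real n powr (r / real CARD('d)) * distortion N r (density lborel (\<lambda>x. ennreal (f x))) (\<alpha> n))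
       \<longlonglongrightarrow> Q_const N r f"

definition dilate :: "real \<Rightarrow> real ^ 'd \<Rightarrow> (real ^ 'd) set \<Rightarrow> (real ^ 'd) set" where
  "dilate \<theta> m \<alpha> = (\<lambda>a. m + \<theta> *\<^sub>R (a - m)) ` \<alpha>"

definition pos_def :: "real ^ 'd ^ 'd \<Rightarrow> bool" where
  "pos_def S \<longleftrightarrow> transpose S = S \<and> (\<forall>x. x \<noteq> 0 \<longrightarrow> x \<bullet> (S *v x) > 0)"

definition gaussian_density :: "real ^ 'd \<Rightarrow> real ^ 'd ^ 'd \<Rightarrow> real ^ 'd \<Rightarrow> real" where
  "gaussian_density m S x =
     exp (- ((x - m) \<bullet> (matrix_inv S *v (x - m))) / 2) / sqrt ((2 * pi) ^ CARD('d) * det S)"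

end

theory Submission
  imports Defs
begin

text \<open>
  Write \<open>d = CARD('d)\<close>, \<open>q = r / d\<close>, \<open>p = d / (d + r) = 1 / (1 + q)\<close>, \<open>J = J_const N r\<close>.

  \<^emph>\<open>Reduction.\<close> The density of a Gaussian is, up to a constant factor, \<open>exp (- u(x - m) / 2)\<close> with a
  quadratic form \<open>u\<close>. Dilating by \<open>\<theta>\<close> about \<open>m\<close> multiplies \<open>u\<close> by
  \<open>\<theta>\<^sup>2 = (s + d) / (r + d)\<close>, which turns the exponent \<open>d / (d + s)\<close> into \<open>d / (d + r)\<close>: composed
  with the dilation, \<open>f powr (d / (d + s))\<close> is a constant multiple of \<open>f powr p\<close>. A change of
  variables therefore reduces the claim to the empirical measure theorem for the undilated sequence
  and the exponent \<open>r\<close> itself (\<open>empirical_measure_convergence\<close>).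

  \<^emph>\<open>Empirical measure theorem.\<close> For a set \<open>U\<close> let \<open>E\<^sub>n(U)\<close> be \<open>n powr q\<close> times the part of the
  distortion of \<open>\<alpha>\<^sub>n\<close> that is collected on \<open>U\<close>, and \<open>v\<^sub>n(U) = card (\<alpha>\<^sub>n \<inter> U) / n\<close>. The heart of the
  proof is a local lower bound for the distortion plus a linear price on the points
  (\<open>eventually_local_cost_ge\<close>): for open \<open>U\<close> and every \<open>\<mu> > 0\<close>,
  \<open>liminf (E\<^sub>n(U) + q \<mu> v\<^sub>n(U)) \<ge> c(\<mu>) \<integral>\<^sub>U f powr p\<close> where \<open>c(\<mu>) = (1 + q) J\<^sup>p \<mu>\<^bsup>1 - p\<^esup>\<close>.

  Let \<open>C\<close> be the integral of \<open>f powr p\<close> over the whole space, \<open>G\<close> its integral over \<open>B\<close>, and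
  \<open>Q = J C\<^bsup>1 / p\<^esup>\<close> the limit that asymptotic optimality prescribes for the total. Apply the local
  bound with price \<open>\<mu>\<close> to the interior of \<open>B\<close> and with price \<open>Q\<close> to its exterior, and add. Since
  \<open>c(Q) C = (1 + q) Q\<close>, the bounds are tight at \<open>\<mu> = Q\<close>, and what remains in the limit is
  \<open>(c(\<mu>) - c(Q)) G \<le> q (\<mu> - Q) v\<^sub>n(B)\<close>. Dividing by \<open>q (\<mu> - Q)\<close> and letting \<open>\<mu>\<close> tend to \<open>Q\<close> from
  either side squeezes \<open>v\<^sub>n(B)\<close> to \<open>c'(Q) G / q = G / C\<close>.

  \<^emph>\<open>Local bound.\<close> \<open>J\<close> is an infimum over all \<open>n\<close>, so every finite set \<open>\<beta>\<close> has distortion at least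
  \<open>J h\<^bsup>d + r\<^esup> (card \<beta>)\<^bsup>- q\<^esup>\<close> on a cube of side \<open>h\<close>. A fixed number of additional points in the cube
  makes the points of \<open>\<alpha>\<^sub>n\<close> outside a slightly larger cube irrelevant
  (\<open>cell_distortion_lower_bound\<close>). A weighted arithmetic-geometric mean inequality then bounds
  distortion plus price on one cube (\<open>cell_cost_lower_bound\<close>). This bound is additive, and it is
  integrated over all positions of the cube in \<open>U\<close> rather than summed over a partition
  (\<open>averaged_cost_lower_bound\<close>).
\<close>

section \<open>Norms and distances to finite sets\<close>

lemma is_norm_zero: "is_norm N \<Longrightarrow> N 0 = 0"
  and is_norm_nonneg: "is_norm N \<Longrightarrow> N x \<ge> 0"
  and is_norm_pos: "is_norm N \<Longrightarrow> x \<noteq> 0 \<Longrightarrow> N x > 0"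
  and is_norm_scaleR: "is_norm N \<Longrightarrow> N (c *\<^sub>R x) = \<bar>c\<bar> * N x"
  and is_norm_add: "is_norm N \<Longrightarrow> N (x + y) \<le> N x + N y"
  by (auto simp: is_norm_def less_le)

lemma is_norm_sum_le:
  assumes "is_norm N" "finite I"
  shows "N (\<Sum>i\<in>I. v i) \<le> (\<Sum>i\<in>I. N (v i))"
  using assms(2)
proof (induction I)
  case (insert i I)
  then show ?case
    using is_norm_add[OF assms(1), of "v i" "\<Sum>i\<in>I. v i"] by simp
qed (simp add: is_norm_zero[OF assms(1)])

lemma is_norm_upper_bound:
  fixes N :: "real ^ 'd \<Rightarrow> real"
  assumes "is_norm N"
  obtains C where "C > 0" "\<And>x. N x \<le> C * norm x"
proof -
  define C where "C = (\<Sum>b\<in>Basis. N (b :: real ^ 'd)) + 1"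
  have nn: "(\<Sum>b\<in>Basis. N (b :: real ^ 'd)) \<ge> 0"
    by (intro sum_nonneg is_norm_nonneg assms)
  have "N x \<le> C * norm x" for x
  proof -
    have "N x = N (\<Sum>b\<in>Basis. (x \<bullet> b) *\<^sub>R b)"
      by (simp add: euclidean_representation)
    also have "\<dots> \<le> (\<Sum>b\<in>Basis. N ((x \<bullet> b) *\<^sub>R b))"
      by (rule is_norm_sum_le[OF assms]) simp
    also have "\<dots> \<le> (\<Sum>b\<in>Basis. norm x * N b)"
      by (intro sum_mono)
         (simp add: is_norm_scaleR[OF assms] Basis_le_norm mult_right_mono is_norm_nonneg[OF assms])
    also have "\<dots> \<le> C * norm x"
      by (simp add: C_def sum_distrib_left algebra_simps)
    finally show ?thesis .
  qed
  moreover have "C > 0" using nn by (simp add: C_def)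
  ultimately show ?thesis using that by blast
qed

lemma is_norm_abs_diff_le:
  assumes "is_norm N"
  shows "\<bar>N x - N y\<bar> \<le> N (x - y)"
proof -
  have "N x \<le> N (x - y) + N y" "N y \<le> N (y - x) + N x"
    using is_norm_add[OF assms, of "x - y" y] is_norm_add[OF assms, of "y - x" x] by auto
  moreover have "N (y - x) = N (x - y)"
    using is_norm_scaleR[OF assms, of "-1" "x - y"] by simp
  ultimately show ?thesis by linarith
qed

lemma is_norm_continuous_on:
  fixes N :: "real ^ 'd \<Rightarrow> real"
  assumes "is_norm N"
  shows "continuous_on S N"
proof -
  obtain C where C: "C > 0" "\<And>x. N x \<le> C * norm x"
    using is_norm_upper_bound[OF assms] by blast
  have "C-lipschitz_on UNIV N"
    using C is_norm_abs_diff_le[OF assms]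
    by (intro lipschitz_onI) (auto simp: dist_norm intro: order_trans)
  then show ?thesis
    by (meson continuous_on_subset lipschitz_on_continuous_on subset_UNIV)
qed

lemma is_norm_lower_bound:
  fixes N :: "real ^ 'd \<Rightarrow> real"
  assumes "is_norm N"
  obtains c where "c > 0" "\<And>x. c * norm x \<le> N x"
proof -
  obtain x0 where x0: "x0 \<in> sphere 0 1" "\<And>x. x \<in> sphere 0 1 \<Longrightarrow> N x0 \<le> N x"
    using continuous_attains_inf[OF compact_sphere _ is_norm_continuous_on[OF assms], of 0 1] by auto
  have "N x0 * norm x \<le> N x" for x
  proof (cases "x = 0")
    case False
    then have "N x0 \<le> N ((1 / norm x) *\<^sub>R x)"
      by (intro x0(2)) simp
    also have "\<dots> = N x / norm x"
      by (simp add: is_norm_scaleR[OF assms])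
    finally show ?thesis using False by (simp add: field_simps)
  qed (simp add: is_norm_zero[OF assms])
  moreover have "N x0 > 0"
    using x0(1) by (intro is_norm_pos[OF assms]) auto
  ultimately show ?thesis using that by blast
qed

lemma set_dist_le: "finite \<alpha> \<Longrightarrow> a \<in> \<alpha> \<Longrightarrow> set_dist N x \<alpha> \<le> N (x - a)"
  by (simp add: set_dist_def)

lemma set_dist_attained:
  assumes "finite \<alpha>" "\<alpha> \<noteq> {}"
  obtains a where "a \<in> \<alpha>" "set_dist N x \<alpha> = N (x - a)"
proof -
  have "set_dist N x \<alpha> \<in> (\<lambda>a. N (x - a)) ` \<alpha>"
    unfolding set_dist_def using assms by (intro Min_in) auto
  then show ?thesis using that by blast
qed

lemma set_dist_nonneg:
  "is_norm N \<Longrightarrow> finite \<alpha> \<Longrightarrow> \<alpha> \<noteq> {} \<Longrightarrow> set_dist N x \<alpha> \<ge> 0"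
  by (metis is_norm_nonneg set_dist_attained)

lemma set_dist_affine:
  assumes "is_norm N" "finite \<alpha>" "\<alpha> \<noteq> {}" "h > 0"
  shows "set_dist N (z + h *\<^sub>R x) ((\<lambda>a. z + h *\<^sub>R a) ` \<alpha>) = h * set_dist N x \<alpha>"
proof -
  have "(\<lambda>a. N (z + h *\<^sub>R x - a)) ` (\<lambda>a. z + h *\<^sub>R a) ` \<alpha> = (\<lambda>t. h * t) ` (\<lambda>a. N (x - a)) ` \<alpha>"
    unfolding image_image
    using is_norm_scaleR[OF assms(1), of h] assms(4) by (simp flip: scaleR_diff_right)
  also have "Min \<dots> = h * Min ((\<lambda>a. N (x - a)) ` \<alpha>)"
    using assms by (intro mono_Min_commute[symmetric] monoI) auto
  finally show ?thesis by (simp add: set_dist_def)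
qed

lemma continuous_on_set_dist:
  fixes N :: "real ^ 'd \<Rightarrow> real"
  assumes "is_norm N" "finite \<alpha>" "\<alpha> \<noteq> {}"
  shows "continuous_on S (\<lambda>x. set_dist N x \<alpha>)"
  using assms(2,3)
proof (induction rule: finite_ne_induct)
  case (singleton a)
  show ?case
    unfolding set_dist_def
    by (simp, intro continuous_on_compose2[OF is_norm_continuous_on[OF assms(1), of UNIV]] continuous_intros) auto
next
  case (insert a \<alpha>)
  have "continuous_on S (\<lambda>x. min (N (x - a)) (set_dist N x \<alpha>))"
    by (intro continuous_intros insert.IH
         continuous_on_compose2[OF is_norm_continuous_on[OF assms(1), of UNIV]]) auto
  then show ?case
    using insert.hyps by (simp add: set_dist_def)
qed

lemma continuous_on_set_dist_powr:
  fixes N :: "real ^ 'd \<Rightarrow> real"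
  assumes "is_norm N" "finite \<alpha>" "\<alpha> \<noteq> {}" "r > 0"
  shows "continuous_on S (\<lambda>x. set_dist N x \<alpha> powr r)"
  using assms by (intro continuous_on_powr' continuous_on_set_dist continuous_on_const) (auto simp: set_dist_nonneg)

lemma set_dist_powr_measurable:
  fixes N :: "real ^ 'd \<Rightarrow> real"
  assumes "is_norm N" "finite \<alpha>" "\<alpha> \<noteq> {}" "r > 0"
  shows "(\<lambda>x. set_dist N x \<alpha> powr r) \<in> borel_measurable borel"
  using continuous_on_set_dist_powr[OF assms, of UNIV] by (rule borel_measurable_continuous_onI)

lemma set_integrable_set_dist_powr:
  fixes N :: "real ^ 'd \<Rightarrow> real"
  assumes "is_norm N" "finite \<alpha>" "\<alpha> \<noteq> {}" "r > 0" "compact S"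
  shows "set_integrable lborel S (\<lambda>x. set_dist N x \<alpha> powr r)"
  unfolding set_integrable_def
  using assms by (intro borel_integrable_compact continuous_on_set_dist_powr) auto

lemma emeasure_lborel_cube:
  fixes z :: "real ^ 'd"
  assumes "u \<le> v"
  shows "emeasure lborel (cbox (z + u *\<^sub>R 1) (z + v *\<^sub>R 1)) = ennreal ((v - u) ^ CARD('d))"
proof -
  have "(z + u *\<^sub>R 1) \<bullet> b \<le> (z + v *\<^sub>R 1) \<bullet> b" "(z + v *\<^sub>R 1 - (z + u *\<^sub>R 1)) \<bullet> b = v - u" if "b \<in> Basis" for b
    using that assms by (auto simp: Basis_vec_def inner_axis)
  then show ?thesis
    using assms by (simp add: prod_ennreal)
qed

lemma cube_affine_image_iff:
  fixes z :: "real ^ 'd"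
  assumes "h > 0"
  shows "z + h *\<^sub>R x \<in> cbox z (z + h *\<^sub>R 1) \<longleftrightarrow> x \<in> cbox 0 1"
  using assms by (auto simp: mem_box_cart zero_le_mult_iff)

lemma distortion_unit_cube:
  fixes N :: "real ^ 'd \<Rightarrow> real"
  assumes "is_norm N" "finite \<alpha>" "\<alpha> \<noteq> {}" "r > 0"
  shows "distortion N r (uniform_measure lborel (cbox (0 :: real ^ 'd) 1)) \<alpha> =
    (LINT x:cbox 0 1|lborel. set_dist N x \<alpha> powr r)"
proof -
  have 1: "emeasure lborel (cbox (0 :: real ^ 'd) 1) = 1"
    using emeasure_lborel_cube[of 0 1 "0 :: real ^ 'd"] by simp
  have 2: "uniform_measure lborel (cbox (0 :: real ^ 'd) 1) = density lborel (\<lambda>x. ennreal (indicator (cbox 0 1) x))"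
    unfolding uniform_measure_def 1 by (intro density_cong) (auto simp: indicator_def)
  show ?thesis
    unfolding distortion_def 2 set_lebesgue_integral_def
    using set_dist_powr_measurable[OF assms] by (subst integral_density) auto
qed

section \<open>Quantization of cubes\<close>

lemma lborel_integral_affine:
  fixes F :: "real ^ 'd \<Rightarrow> real"
  assumes "c \<noteq> 0" and [measurable]: "F \<in> borel_measurable borel"
  shows "(LINT x|lborel. F x) = \<bar>c\<bar> ^ CARD('d) * (LINT x|lborel. F (t + c *\<^sub>R x))"
proof -
  have "(LINT x|lborel. F x) =
      (LINT x|density (distr lborel borel (\<lambda>x. t + c *\<^sub>R x)) (\<lambda>_. ennreal (\<bar>c\<bar> ^ DIM(real ^ 'd))). F x)"
    using lborel_affine[OF assms(1), of t] by (simp add: ennreal_power)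
  also have "\<dots> = \<bar>c\<bar> ^ CARD('d) * (LINT x|lborel. F (t + c *\<^sub>R x))"
    by (subst integral_density) (auto simp: integral_distr)
  finally show ?thesis .
qed

lemma distortion_nonneg: "distortion N r P \<alpha> \<ge> 0"
  by (simp add: distortion_def)

lemma quant_error_nonneg: "k \<ge> 1 \<Longrightarrow> quant_error N r P k \<ge> 0"
  unfolding quant_error_def
  by (rule cINF_greatest) (auto intro!: exI[of _ "{undefined}"])

text \<open>
  Because \<open>J\<close> is an infimum over all numbers of points, it bounds the distortion of each single finite
  set, with no error term.
\<close>

lemma J_const_le:
  fixes N :: "real ^ 'd \<Rightarrow> real"
  assumes "is_norm N" "finite \<alpha>" "\<alpha> \<noteq> {}" "r > 0"
  shows "J_const N r \<le> real (card \<alpha>) powr (r / real CARD('d)) *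
           (LINT x:cbox 0 1|lborel. set_dist N x \<alpha> powr r)"
proof -
  let ?P = "uniform_measure lborel (cbox (0 :: real ^ 'd) 1)"
  have card: "card \<alpha> \<ge> 1"
    using assms by (simp add: Suc_le_eq card_gt_0_iff)
  have "J_const N r \<le> real (card \<alpha>) powr (r / real CARD('d)) * quant_error N r ?P (card \<alpha>) powr r"
    unfolding J_const_def by (rule cINF_lower) (use card in \<open>auto intro!: bdd_belowI[of _ 0]\<close>)
  also have "quant_error N r ?P (card \<alpha>) powr r \<le> (distortion N r ?P \<alpha> powr (1 / r)) powr r"
  proof (rule powr_mono2)
    show "quant_error N r ?P (card \<alpha>) \<le> distortion N r ?P \<alpha> powr (1 / r)"
      unfolding quant_error_def
      by (rule cINF_lower) (use assms in \<open>auto intro!: bdd_belowI[of _ 0]\<close>)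
  qed (use assms card quant_error_nonneg in auto)
  also have "\<dots> = distortion N r ?P \<alpha>"
    using assms(4) distortion_nonneg[of N r ?P \<alpha>] by (simp add: powr_powr)
  also have "\<dots> = (LINT x:cbox 0 1|lborel. set_dist N x \<alpha> powr r)"
    by (rule distortion_unit_cube[OF assms])
  finally show ?thesis by (simp add: mult_left_mono)
qed

text \<open>
  The points of the unit cube that are near \<open>\<alpha>\<close> are covered by \<open>card \<alpha>\<close> small boxes. If each box has
  volume \<open>1 / (2 * card \<alpha>)\<close>, at least half of the cube stays at a distance of order
  \<open>card \<alpha> powr - (1 / d)\<close> from \<open>\<alpha>\<close>.
\<close>

lemma unit_cube_distortion_lower_bound:
  fixes N :: "real ^ 'd \<Rightarrow> real"
  assumes "is_norm N" "r > 0"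
  obtains c where "c > 0"
    "\<And>\<alpha>. finite \<alpha> \<Longrightarrow> \<alpha> \<noteq> {} \<Longrightarrow>
       c * real (card \<alpha>) powr - (r / real CARD('d)) \<le> (LINT x:cbox 0 1|lborel. set_dist N x \<alpha> powr r)"
proof -
  let ?d = "real CARD('d)"
  obtain c where c: "c > 0" "\<And>x. c * norm x \<le> N x"
    using is_norm_lower_bound[OF assms(1)] by blast
  define c0 where "c0 = (c / 2) powr r / 2 * 2 powr - (r / ?d)"
  have "c0 > 0" using c by (simp add: c0_def)
  moreover have "c0 * real (card \<alpha>) powr - (r / ?d) \<le> (LINT x:cbox 0 1|lborel. set_dist N x \<alpha> powr r)"
    if \<alpha>: "finite \<alpha>" "\<alpha> \<noteq> {}" for \<alpha>
  proof -
    define k where "k = real (card \<alpha>)"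
    have k: "k \<ge> 1" using \<alpha> by (simp add: k_def Suc_le_eq card_gt_0_iff)
    \<comment> \<open>half the side of a box of volume \<open>1 / (2 * k)\<close>\<close>
    define u where "u = (1 / (2 * k)) powr (1 / ?d) / 2"
    define t where "t = c * u"
    have u: "u > 0" using k by (simp add: u_def)
    have t: "t > 0" using u c by (simp add: t_def)
    define W where "W = (\<Union>a\<in>\<alpha>. cbox (a + (-u) *\<^sub>R 1) (a + u *\<^sub>R 1))"
    have W_sets: "W \<in> sets lborel" using \<alpha> by (auto simp: W_def)
    have "emeasure lborel W \<le> (\<Sum>a\<in>\<alpha>. emeasure lborel (cbox (a + (-u) *\<^sub>R 1) (a + u *\<^sub>R 1)))"
      unfolding W_def by (rule emeasure_subadditive_finite) (use \<alpha> in auto)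
    also have "\<dots> = (\<Sum>a\<in>\<alpha>. ennreal (1 / (2 * k)))"
    proof (rule sum.cong[OF refl])
      fix a :: "real ^ 'd"
      have "(u - - u) ^ CARD('d) = ((1 / (2 * k)) powr (1 / ?d)) powr ?d"
        using k by (simp add: u_def powr_realpow)
      also have "\<dots> = 1 / (2 * k)" using k by (simp add: powr_powr)
      finally show "emeasure lborel (cbox (a + (-u) *\<^sub>R 1) (a + u *\<^sub>R 1)) = ennreal (1 / (2 * k))"
        using u by (subst emeasure_lborel_cube) auto
    qed
    also have "\<dots> = ennreal (k * (1 / (2 * k)))"
      by (simp add: ennreal_of_nat_eq_real_of_nat k_def flip: ennreal_mult)
    also have "k * (1 / (2 * k)) = 1 / 2" using k by simp
    finally have W: "emeasure lborel W \<le> ennreal (1 / 2)" .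
    have W_fin: "emeasure lborel W < \<infinity>"
      using le_less_trans[OF W ennreal_less_top] by (simp only: infinity_ennreal_def)
    have cube1: "emeasure lborel (cbox (0 :: real ^ 'd) 1) = ennreal 1"
      using emeasure_lborel_cube[of 0 1 "0 :: real ^ 'd"] by simp
    let ?D = "cbox 0 1 - W"
    have D_fin: "emeasure lborel ?D < \<infinity>"
      using emeasure_mono[of ?D "cbox 0 1" lborel] W_sets cube1 by (auto simp: le_less_trans)
    have "measure lborel (cbox (0 :: real ^ 'd) 1) \<le> measure lborel (?D \<union> W)"
      using D_fin W_fin W_sets
      by (intro measure_mono_fmeasurable fmeasurable.Un) (auto simp: fmeasurable_def)
    also have "\<dots> \<le> measure lborel ?D + measure lborel W"
      using W_sets by (intro measure_Un_le) auto
    also have "measure lborel W \<le> 1 / 2"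
      unfolding measure_def by (intro enn2real_leI W) simp
    finally have D: "measure lborel ?D \<ge> 1 / 2"
      using cube1 by (simp add: measure_def)
    have far: "t \<le> set_dist N x \<alpha>" if x: "x \<notin> W" for x
    proof -
      obtain a where a: "a \<in> \<alpha>" "set_dist N x \<alpha> = N (x - a)"
        using set_dist_attained[OF \<alpha>] by blast
      have "x \<notin> cbox (a + (-u) *\<^sub>R 1) (a + u *\<^sub>R 1)"
        using x a(1) by (auto simp: W_def)
      then obtain i where "\<not> (a $ i - u \<le> x $ i \<and> x $ i \<le> a $ i + u)"
        by (auto simp: mem_box_cart)
      then have "u < \<bar>(x - a) $ i\<bar>" by auto
      also have "\<dots> \<le> norm (x - a)" by (rule component_le_norm_cart)
      finally have "t \<le> c * norm (x - a)" using c by (simp add: t_def)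
      also have "\<dots> \<le> N (x - a)" by (rule c)
      finally show ?thesis by (simp add: a)
    qed
    have "t powr r * (1 / 2) \<le> t powr r * measure lborel ?D"
      using D by (intro mult_left_mono) auto
    also have "\<dots> = (LINT x|lborel. indicator ?D x * t powr r)" by simp
    also have "\<dots> \<le> (LINT x|lborel. indicator (cbox 0 1) x *\<^sub>R set_dist N x \<alpha> powr r)"
    proof (rule integral_mono)
      show "integrable lborel (\<lambda>x. indicator ?D x * t powr r)"
        using D_fin W_sets by (intro integrable_mult_left integrable_real_indicator) auto
      show "integrable lborel (\<lambda>x. indicat_real (cbox 0 1) x *\<^sub>R set_dist N x \<alpha> powr r)"
        using set_integrable_set_dist_powr[OF assms(1) \<alpha> assms(2) compact_cbox]
        by (simp add: set_integrable_def)
    qed (use far t assms(2) in \<open>auto simp: indicator_def intro!: powr_mono2\<close>)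
    finally have *: "t powr r * (1 / 2) \<le> (LINT x:cbox 0 1|lborel. set_dist N x \<alpha> powr r)"
      by (simp add: set_lebesgue_integral_def)
    have "t powr r * (1 / 2) = (c / 2 * (2 * k) powr - (1 / ?d)) powr r / 2"
      using k by (simp add: t_def u_def powr_divide powr_minus field_simps)
    also have "(c / 2 * (2 * k) powr - (1 / ?d)) powr r = (c / 2) powr r * ((2 * k) powr - (1 / ?d)) powr r"
      by (rule powr_mult)
    also have "((2 * k) powr - (1 / ?d)) powr r = 2 powr - (r / ?d) * k powr - (r / ?d)"
      using k by (simp add: powr_mult powr_powr)
    also have "(c / 2) powr r * (2 powr - (r / ?d) * k powr - (r / ?d)) / 2 = c0 * k powr - (r / ?d)"
      by (simp add: c0_def)
    finally show ?thesis using * by (simp add: k_def)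
  qed
  ultimately show ?thesis using that by blast
qed

text \<open>
  Positivity of \<open>J\<close> makes the limit \<open>Q\<close> that asymptotic optimality prescribes positive, so that \<open>Q\<close> can
  serve as a price for points and misplaced points cost something.
\<close>

lemma J_const_pos:
  fixes N :: "real ^ 'd \<Rightarrow> real"
  assumes "is_norm N" "r > 0"
  shows "J_const N r > 0"
proof -
  let ?d = "real CARD('d)" and ?P = "uniform_measure lborel (cbox (0 :: real ^ 'd) 1)"
  obtain c where c: "c > 0"
    "\<And>\<alpha>. finite \<alpha> \<Longrightarrow> \<alpha> \<noteq> {} \<Longrightarrow>
       c * real (card \<alpha>) powr - (r / ?d) \<le> (LINT x:cbox 0 1|lborel. set_dist N x \<alpha> powr r)"
    using unit_cube_distortion_lower_bound[OF assms] by blast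
  have "c \<le> J_const N r"
    unfolding J_const_def
  proof (rule cINF_greatest)
    fix n :: nat assume "n \<in> {1..}"
    then have n: "n \<ge> 1" by simp
    have "(c * real n powr - (r / ?d)) powr (1 / r) \<le> quant_error N r ?P n"
      unfolding quant_error_def
    proof (rule cINF_greatest)
      show "{\<alpha> :: (real ^ 'd) set. finite \<alpha> \<and> \<alpha> \<noteq> {} \<and> card \<alpha> \<le> n} \<noteq> {}"
        using n by (auto intro!: exI[of _ "{undefined}"])
      fix \<alpha> :: "(real ^ 'd) set"
      assume "\<alpha> \<in> {\<alpha>. finite \<alpha> \<and> \<alpha> \<noteq> {} \<and> card \<alpha> \<le> n}"
      then have \<alpha>: "finite \<alpha>" "\<alpha> \<noteq> {}" "card \<alpha> \<le> n" by auto
      have "c * real n powr - (r / ?d) \<le> c * real (card \<alpha>) powr - (r / ?d)"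
        using \<alpha> c assms by (intro mult_left_mono powr_mono2') (auto simp: card_gt_0_iff)
      also have "\<dots> \<le> distortion N r ?P \<alpha>"
        using c(2)[OF \<alpha>(1,2)] distortion_unit_cube[OF assms(1) \<alpha>(1,2) assms(2)] by simp
      finally show "(c * real n powr - (r / ?d)) powr (1 / r) \<le> distortion N r ?P \<alpha> powr (1 / r)"
        using c assms by (intro powr_mono2) auto
    qed
    then have "((c * real n powr - (r / ?d)) powr (1 / r)) powr r \<le> quant_error N r ?P n powr r"
      using assms by (intro powr_mono2) auto
    then have "c * real n powr - (r / ?d) \<le> quant_error N r ?P n powr r"
      using assms c by (simp add: powr_powr)
    then have "real n powr (r / ?d) * (c * real n powr - (r / ?d)) \<le>
        real n powr (r / ?d) * quant_error N r ?P n powr r"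
      by (intro mult_left_mono) auto
    moreover have "real n powr (r / ?d) * (c * real n powr - (r / ?d)) = c"
      using n by (simp add: powr_minus)
    ultimately show "c \<le> real n powr (r / ?d) * quant_error N r ?P n powr r"
      by simp
  qed auto
  with c show ?thesis by simp
qed

text \<open>
  Scaling the unit cube to side \<open>h\<close> multiplies volume by \<open>h\<^sup>d\<close> and the \<open>r\<close>-th power of distances by
  \<open>h\<^sup>r\<close>.
\<close>

lemma cube_distortion_lower_bound:
  fixes N :: "real ^ 'd \<Rightarrow> real"
  assumes "is_norm N" "r > 0" "finite \<beta>" "\<beta> \<noteq> {}" "h > 0"
  shows "J_const N r * h powr (real CARD('d) + r) * real (card \<beta>) powr - (r / real CARD('d))
    \<le> (LINT x:cbox z (z + h *\<^sub>R 1)|lborel. set_dist N x \<beta> powr r)"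
proof -
  let ?d = "real CARD('d)" and ?C = "cbox z (z + h *\<^sub>R 1)"
  define \<beta>' where "\<beta>' = (\<lambda>b. (1 / h) *\<^sub>R (b - z)) ` \<beta>"
  have \<beta>: "\<beta> = (\<lambda>b. z + h *\<^sub>R b) ` \<beta>'"
    using assms by (simp add: \<beta>'_def image_image)
  have \<beta>': "finite \<beta>'" "\<beta>' \<noteq> {}" using assms by (auto simp: \<beta>'_def)
  have card: "card \<beta>' = card \<beta>"
    unfolding \<beta>'_def using assms by (intro card_image inj_onI) auto
  have card_pos: "card \<beta> > 0" using assms by (simp add: card_gt_0_iff)
  have "(LINT x:?C|lborel. set_dist N x \<beta> powr r) =
      h ^ CARD('d) * (LINT x|lborel. indicator ?C (z + h *\<^sub>R x) *\<^sub>R set_dist N (z + h *\<^sub>R x) \<beta> powr r)"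
    unfolding set_lebesgue_integral_def
    using assms(5) set_dist_powr_measurable[OF assms(1,3,4,2)]
    by (subst lborel_integral_affine[of h _ z]) auto
  also have "(\<lambda>x. indicator ?C (z + h *\<^sub>R x) *\<^sub>R set_dist N (z + h *\<^sub>R x) \<beta> powr r) =
      (\<lambda>x. h powr r * (indicator (cbox 0 1) x *\<^sub>R set_dist N x \<beta>' powr r))"
    using assms(5) set_dist_nonneg[OF assms(1) \<beta>']
    by (intro ext) (auto simp: \<beta> indicator_def cube_affine_image_iff
         set_dist_affine[OF assms(1) \<beta>' assms(5)] powr_mult)
  also have "(LINT x|lborel. h powr r * (indicator (cbox 0 1) x *\<^sub>R set_dist N x \<beta>' powr r)) =
      h powr r * (LINT x:cbox 0 1|lborel. set_dist N x \<beta>' powr r)"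
    by (simp add: set_lebesgue_integral_def)
  also have "h ^ CARD('d) * (h powr r * (LINT x:cbox 0 1|lborel. set_dist N x \<beta>' powr r)) =
      h powr (?d + r) * (LINT x:cbox 0 1|lborel. set_dist N x \<beta>' powr r)"
    using assms(5) by (simp add: powr_add powr_realpow)
  finally have eq: "(LINT x:?C|lborel. set_dist N x \<beta> powr r) = \<dots>" .
  have "J_const N r * real (card \<beta>) powr - (r / ?d) \<le>
      (real (card \<beta>) powr (r / ?d) * (LINT x:cbox 0 1|lborel. set_dist N x \<beta>' powr r)) *
      real (card \<beta>) powr - (r / ?d)"
    using J_const_le[OF assms(1) \<beta>' assms(2)] card by (intro mult_right_mono) auto
  also have "\<dots> = (LINT x:cbox 0 1|lborel. set_dist N x \<beta>' powr r)"
    using card_pos by (simp add: powr_minus)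
  finally have "h powr (?d + r) * (J_const N r * real (card \<beta>) powr - (r / ?d)) \<le>
      h powr (?d + r) * (LINT x:cbox 0 1|lborel. set_dist N x \<beta>' powr r)"
    by (rule mult_left_mono) simp
  then show ?thesis
    unfolding eq by (simp only: mult_ac)
qed

section \<open>One cell of a large quantizer\<close>

text \<open>
  The weighted arithmetic-geometric mean inequality with weights \<open>1 / (1 + q)\<close> and \<open>q / (1 + q)\<close>, an
  equality when \<open>v powr (1 + q) = a / \<mu>\<close>. Here \<open>v\<close> is the share of the points spent on a cell,
  \<open>a * v powr - q\<close> the distortion that it leaves there, and \<open>q * \<mu>\<close> the price of a unit of points. In
  contrast to Hoelder's inequality, the price is linear in \<open>v\<close>, so that the bounds for different cells
  can be added.
\<close>

lemma powr_tradeoff_lower_bound: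
  fixes q a \<mu> v :: real
  assumes "q > 0" "a \<ge> 0" "\<mu> > 0" "v > 0"
  shows "(1 + q) * a powr (1 / (1 + q)) * \<mu> powr (q / (1 + q)) \<le> a * v powr - q + q * \<mu> * v"
proof (cases "a = 0")
  case False
  then have a: "a > 0" using assms by simp
  let ?X = "(1 + q) * (a * v powr - q)" and ?Y = "(1 + q) * (\<mu> * v)"
  have one: "1 / (1 + q) + q / (1 + q) = 1"
    using assms by (simp add: field_simps)
  have "?X powr (1 / (1 + q)) * ?Y powr (q / (1 + q)) \<le> 1 / (1 + q) * ?X + q / (1 + q) * ?Y"
    using assms a one by (intro Youngs_inequality_0) auto
  also have "1 / (1 + q) * ?X + q / (1 + q) * ?Y = a * v powr - q + q * \<mu> * v"
  proof -
    have "1 + q \<noteq> 0" using assms by simp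
    then show ?thesis by simp
  qed
  also have "?X powr (1 / (1 + q)) * ?Y powr (q / (1 + q)) =
      ((1 + q) powr (1 / (1 + q)) * (1 + q) powr (q / (1 + q))) * a powr (1 / (1 + q)) *
      \<mu> powr (q / (1 + q)) * (v powr (- q / (1 + q)) * v powr (q / (1 + q)))"
    using assms a by (simp add: powr_mult powr_powr mult_ac)
  also have "\<dots> = (1 + q) * a powr (1 / (1 + q)) * \<mu> powr (q / (1 + q))"
    using assms one by (simp flip: powr_add)
  finally show ?thesis .
qed (use assms in auto)

text \<open>
  Points of \<open>\<alpha>\<close> outside the cube \<open>C = z + h [0, 1]\<^sup>d\<close> may serve parts of \<open>C\<close>, so \<open>card (\<alpha> \<inter> C)\<close>
  alone does not control the distortion on \<open>C\<close>. But a point beyond a margin of width \<open>\<tau> h\<close> is at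
  least as far from every \<open>x \<in> C\<close> as the nearest point of a fine enough net of \<open>C\<close>. Replacing all such
  points by the net only decreases distances. By scaling, the size \<open>M\<close> of the net depends neither on
  \<open>h\<close> nor on \<open>\<alpha>\<close>, and it becomes negligible when \<open>\<alpha>\<close> is large.
\<close>

lemma cell_distortion_lower_bound:
  fixes N :: "real ^ 'd \<Rightarrow> real"
  assumes "is_norm N" "r > 0" "\<tau> > 0"
  obtains M :: real where "M > 0"
    "\<And>z h \<alpha>. h > 0 \<Longrightarrow> finite \<alpha> \<Longrightarrow> \<alpha> \<noteq> {} \<Longrightarrow>
      J_const N r * h powr (real CARD('d) + r) *
        (real (card (\<alpha> \<inter> cbox (z + (- (\<tau> * h)) *\<^sub>R 1) (z + ((1 + \<tau>) * h) *\<^sub>R 1))) + M) powr - (r / real CARD('d))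
      \<le> (LINT x:cbox z (z + h *\<^sub>R 1)|lborel. set_dist N x \<alpha> powr r)"
proof -
  let ?d = "real CARD('d)"
  obtain c where c: "c > 0" "\<And>x. c * norm x \<le> N x"
    using is_norm_lower_bound[OF assms(1)] by blast
  obtain C where C: "C > 0" "\<And>x. N x \<le> C * norm x"
    using is_norm_upper_bound[OF assms(1)] by blast
  \<comment> \<open>For \<open>h = 1\<close>, crossing the margin costs at least \<open>c * \<tau>\<close> in \<open>N\<close>; the radius makes the net as fine as
     that in \<open>N\<close>.\<close>
  have "\<exists>k. finite k \<and> cbox (0 :: real ^ 'd) 1 \<subseteq> (\<Union>x\<in>k. ball x (c * \<tau> / C))"
    using compact_cbox[of "0 :: real ^ 'd" 1] c(1) C(1) assms(3)
    unfolding compact_eq_totally_bounded by simp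
  then obtain \<gamma> where \<gamma>: "finite \<gamma>" "cbox (0 :: real ^ 'd) 1 \<subseteq> (\<Union>x\<in>\<gamma>. ball x (c * \<tau> / C))"
    by blast
  have \<gamma>_ne: "\<gamma> \<noteq> {}"
  proof
    assume "\<gamma> = {}"
    moreover have "(0 :: real ^ 'd) \<in> cbox 0 1" by (simp add: mem_box_cart)
    ultimately show False using \<gamma>(2) by auto
  qed
  have net: "\<exists>g\<in>\<gamma>. N (x - g) \<le> c * \<tau>" if x: "x \<in> cbox 0 1" for x
  proof -
    obtain g where "g \<in> \<gamma>" "norm (x - g) < c * \<tau> / C"
      using subsetD[OF \<gamma>(2) x] by (auto simp: dist_norm norm_minus_commute)
    moreover have "N (x - g) \<le> C * norm (x - g)" by (rule C)
    ultimately show ?thesis using C(1) by (intro bexI[of _ g]) (auto simp: field_simps)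
  qed
  define M where "M = real (card \<gamma>)"
  have M: "M > 0" using \<gamma> \<gamma>_ne by (simp add: M_def card_gt_0_iff)
  moreover have "J_const N r * h powr (?d + r) *
        (real (card (\<alpha> \<inter> cbox (z + (- (\<tau> * h)) *\<^sub>R 1) (z + ((1 + \<tau>) * h) *\<^sub>R 1))) + M) powr - (r / ?d)
      \<le> (LINT x:cbox z (z + h *\<^sub>R 1)|lborel. set_dist N x \<alpha> powr r)"
    if h: "h > 0" and \<alpha>: "finite \<alpha>" "\<alpha> \<noteq> {}" for z h \<alpha>
  proof -
    let ?T = "cbox (z + (- (\<tau> * h)) *\<^sub>R 1) (z + ((1 + \<tau>) * h) *\<^sub>R 1)"
    \<comment> \<open>points of \<open>\<alpha>\<close> beyond the margin are exchanged for the net\<close>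
    define \<beta> where "\<beta> = (\<alpha> \<inter> ?T) \<union> (\<lambda>g. z + h *\<^sub>R g) ` \<gamma>"
    have \<beta>: "finite \<beta>" "\<beta> \<noteq> {}" using \<alpha> \<gamma> \<gamma>_ne by (auto simp: \<beta>_def)
    have "card \<beta> \<le> card (\<alpha> \<inter> ?T) + card \<gamma>"
      unfolding \<beta>_def by (rule order_trans[OF card_Un_le]) (simp add: card_image_le \<gamma>)
    then have card: "real (card \<beta>) \<le> real (card (\<alpha> \<inter> ?T)) + M"
      by (simp add: M_def)
    have near: "set_dist N x \<beta> \<le> set_dist N x \<alpha>" if x: "x \<in> cbox z (z + h *\<^sub>R 1)" for x
    proof -
      obtain a where a: "a \<in> \<alpha>" "set_dist N x \<alpha> = N (x - a)"
        using set_dist_attained[OF \<alpha>] by blast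
      show ?thesis
      proof (cases "a \<in> ?T")
        case True
        then show ?thesis
          using a \<beta> by (auto simp: \<beta>_def intro!: set_dist_le)
      next
        case False
        then obtain i where i: "a $ i < z $ i - \<tau> * h \<or> z $ i + (1 + \<tau>) * h < a $ i"
          by (auto simp: mem_box_cart not_le algebra_simps)
        moreover have "z $ i \<le> x $ i" "x $ i \<le> z $ i + h"
          using x by (auto simp: mem_box_cart)
        ultimately have "\<tau> * h \<le> \<bar>(x - a) $ i\<bar>"
          by (auto simp: algebra_simps)
        also have "\<dots> \<le> norm (x - a)" by (rule component_le_norm_cart)
        finally have "c * (\<tau> * h) \<le> c * norm (x - a)" using c by simp
        also have "\<dots> \<le> N (x - a)" by (rule c)
        finally have far: "c * (\<tau> * h) \<le> N (x - a)" .
        define y where "y = (1 / h) *\<^sub>R (x - z)"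
        have xy: "x = z + h *\<^sub>R y" using h by (simp add: y_def)
        obtain g where g: "g \<in> \<gamma>" "N (y - g) \<le> c * \<tau>"
          using net[of y] x h by (auto simp: xy cube_affine_image_iff)
        have "set_dist N x \<beta> \<le> N (x - (z + h *\<^sub>R g))"
          using g \<beta> by (intro set_dist_le) (auto simp: \<beta>_def)
        also have "x - (z + h *\<^sub>R g) = h *\<^sub>R (y - g)"
          by (simp add: xy algebra_simps)
        also have "N (h *\<^sub>R (y - g)) = h * N (y - g)"
          using h by (simp add: is_norm_scaleR[OF assms(1)])
        also have "\<dots> \<le> h * (c * \<tau>)" using g h by simp
        also have "\<dots> \<le> N (x - a)" using far by (simp add: mult_ac)
        finally show ?thesis by (simp add: a)
      qed
    qed
    have "(real (card (\<alpha> \<inter> ?T)) + M) powr - (r / ?d) \<le> real (card \<beta>) powr - (r / ?d)"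
      using \<beta> card assms by (intro powr_mono2') (auto simp: card_gt_0_iff)
    then have "J_const N r * h powr (?d + r) * (real (card (\<alpha> \<inter> ?T)) + M) powr - (r / ?d) \<le>
        J_const N r * h powr (?d + r) * real (card \<beta>) powr - (r / ?d)"
      using J_const_pos[OF assms(1,2)] by (intro mult_left_mono) auto
    also have "\<dots> \<le> (LINT x:cbox z (z + h *\<^sub>R 1)|lborel. set_dist N x \<beta> powr r)"
      by (rule cube_distortion_lower_bound[OF assms(1,2) \<beta> h])
    also have "\<dots> \<le> (LINT x:cbox z (z + h *\<^sub>R 1)|lborel. set_dist N x \<alpha> powr r)"
      using near assms \<alpha> \<beta>
      by (intro set_integral_mono set_integrable_set_dist_powr powr_mono2 set_dist_nonneg) auto
    finally show ?thesis .
  qed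
  ultimately show ?thesis using that by blast
qed

section \<open>Averaging over the positions of a cube\<close>

text \<open>
  Membership in the translated cube is membership of \<open>x - z\<close> in a fixed cube, hence jointly
  measurable in \<open>z\<close> and \<open>x\<close>.
\<close>

lemma moving_cube_measurable:
  fixes u v :: real
  shows "(\<lambda>(z, x). indicator (cbox (z + u *\<^sub>R 1) (z + v *\<^sub>R 1)) x :: ennreal)
    \<in> borel_measurable (lborel \<Otimes>\<^sub>M (lborel :: (real ^ 'd) measure))"
proof -
  have "(\<lambda>(z, x). indicator (cbox (z + u *\<^sub>R 1) (z + v *\<^sub>R 1)) x :: ennreal) =
      (\<lambda>(z, x :: real ^ 'd). indicator (cbox (u *\<^sub>R 1) (v *\<^sub>R 1)) (x - z))"
    by (auto simp: fun_eq_iff indicator_def mem_box_cart algebra_simps)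
  then show ?thesis by simp
qed

lemma moving_cube_corner_measurable:
  fixes x :: "real ^ 'd"
  shows "(\<lambda>z. indicator (cbox (z + u *\<^sub>R 1) (z + v *\<^sub>R 1)) x :: ennreal) \<in> borel_measurable borel"
  using measurable_Pair1[OF moving_cube_measurable[of u v], of x] by simp

lemma nn_integral_moving_cube:
  fixes x :: "real ^ 'd"
  assumes "u \<le> v"
  shows "(\<integral>\<^sup>+z. indicator (cbox (z + u *\<^sub>R 1) (z + v *\<^sub>R 1)) x \<partial>lborel) = ennreal ((v - u) ^ CARD('d))"
proof -
  have "(\<lambda>z. indicator (cbox (z + u *\<^sub>R 1) (z + v *\<^sub>R 1)) x :: ennreal) =
      indicator (cbox (x + (- v) *\<^sub>R 1) (x + (- u) *\<^sub>R 1))"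
    by (auto simp: fun_eq_iff indicator_def mem_box_cart algebra_simps)
  then have "(\<integral>\<^sup>+z. indicator (cbox (z + u *\<^sub>R 1) (z + v *\<^sub>R 1)) x \<partial>lborel) =
      emeasure lborel (cbox (x + (- v) *\<^sub>R 1) (x + (- u) *\<^sub>R 1))"
    by simp
  also have "\<dots> = ennreal ((v - u) ^ CARD('d))"
    using assms by (subst emeasure_lborel_cube) auto
  finally show ?thesis .
qed

text \<open>
  Fubini's theorem: every point of \<open>U\<close> lies in the translated cube for a set of positions \<open>z\<close> whose
  measure is at most the volume of the cube.
\<close>

lemma nn_integral_average_over_cubes_le:
  fixes F :: "real ^ 'd \<Rightarrow> ennreal"
  assumes [measurable]: "F \<in> borel_measurable borel" "K \<in> sets borel" "U \<in> sets borel"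
    and "u \<le> v"
    and sub: "\<And>z. z \<in> K \<Longrightarrow> cbox (z + u *\<^sub>R 1) (z + v *\<^sub>R 1) \<subseteq> U"
  shows "(\<integral>\<^sup>+z. (\<integral>\<^sup>+x. F x * indicator (cbox (z + u *\<^sub>R 1) (z + v *\<^sub>R 1)) x \<partial>lborel) * indicator K z \<partial>lborel)
    \<le> ennreal ((v - u) ^ CARD('d)) * (\<integral>\<^sup>+x. F x * indicator U x \<partial>lborel)"
proof -
  let ?I = "\<lambda>z x. indicator (cbox (z + u *\<^sub>R 1) (z + v *\<^sub>R 1)) x :: ennreal"
  note moving_cube_measurable[of u v, measurable]
  have [measurable]: "(\<lambda>x. ?I z x) \<in> borel_measurable borel" for z by simp
  note moving_cube_corner_measurable[of u v, measurable]
  have "(\<integral>\<^sup>+z. (\<integral>\<^sup>+x. F x * ?I z x \<partial>lborel) * indicator K z \<partial>lborel) =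
      (\<integral>\<^sup>+z. (\<integral>\<^sup>+x. F x * ?I z x * indicator K z \<partial>lborel) \<partial>lborel)"
    by (simp add: nn_integral_multc)
  also have "\<dots> = (\<integral>\<^sup>+x. (\<integral>\<^sup>+z. F x * ?I z x * indicator K z \<partial>lborel) \<partial>lborel)"
    by (rule lborel_pair.Fubini'[symmetric]) measurable
  also have "\<dots> \<le> (\<integral>\<^sup>+x. (\<integral>\<^sup>+z. (F x * indicator U x) * ?I z x \<partial>lborel) \<partial>lborel)"
    using sub by (intro nn_integral_mono) (auto simp: indicator_def)
  also have "\<dots> = (\<integral>\<^sup>+x. (F x * indicator U x) * ennreal ((v - u) ^ CARD('d)) \<partial>lborel)"
    by (subst nn_integral_cmult) (auto simp: nn_integral_moving_cube[OF assms(4)])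
  also have "\<dots> = ennreal ((v - u) ^ CARD('d)) * (\<integral>\<^sup>+x. F x * indicator U x \<partial>lborel)"
    by (subst nn_integral_multc) (auto simp: mult.commute)
  finally show ?thesis .
qed

lemma sum_indicator_eq_ennreal_card:
  assumes "finite A"
  shows "(\<Sum>a\<in>A. indicator S a :: ennreal) = ennreal (real (card (A \<inter> S)))"
  using assms by (simp add: indicator_def sum.If_cases ennreal_of_nat_eq_real_of_nat)

lemma card_in_moving_cube_measurable:
  fixes \<alpha> :: "(real ^ 'd) set"
  assumes "finite \<alpha>"
  shows "(\<lambda>z. ennreal (real (card (\<alpha> \<inter> cbox (z + u *\<^sub>R 1) (z + v *\<^sub>R 1))))) \<in> borel_measurable borel"
proof -
  note moving_cube_corner_measurable[of u v, measurable]
  have "(\<lambda>z. ennreal (real (card (\<alpha> \<inter> cbox (z + u *\<^sub>R 1) (z + v *\<^sub>R 1))))) =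
      (\<lambda>z. \<Sum>a\<in>\<alpha>. indicator (cbox (z + u *\<^sub>R 1) (z + v *\<^sub>R 1)) a)"
    using assms by (simp add: sum_indicator_eq_ennreal_card)
  then show ?thesis by simp
qed

lemma nn_integral_count_in_cubes_le:
  fixes \<alpha> :: "(real ^ 'd) set"
  assumes [measurable]: "K \<in> sets borel"
    and "u \<le> v" "finite \<alpha>"
    and sub: "\<And>z. z \<in> K \<Longrightarrow> cbox (z + u *\<^sub>R 1) (z + v *\<^sub>R 1) \<subseteq> U"
  shows "(\<integral>\<^sup>+z. ennreal (real (card (\<alpha> \<inter> cbox (z + u *\<^sub>R 1) (z + v *\<^sub>R 1)))) * indicator K z \<partial>lborel)
    \<le> ennreal ((v - u) ^ CARD('d) * real (card (\<alpha> \<inter> U)))"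
proof -
  let ?I = "\<lambda>z x. indicator (cbox (z + u *\<^sub>R 1) (z + v *\<^sub>R 1)) x :: ennreal"
  note moving_cube_corner_measurable[of u v, measurable]
  have "ennreal (real (card (\<alpha> \<inter> cbox (z + u *\<^sub>R 1) (z + v *\<^sub>R 1)))) * indicator K z \<le>
      (\<Sum>a\<in>\<alpha> \<inter> U. ?I z a)" for z
  proof (cases "z \<in> K")
    case True
    have "(\<Sum>a\<in>\<alpha> \<inter> U. ?I z a) = ennreal (real (card ((\<alpha> \<inter> U) \<inter> cbox (z + u *\<^sub>R 1) (z + v *\<^sub>R 1))))"
      using assms(3) by (intro sum_indicator_eq_ennreal_card) simp
    also have "(\<alpha> \<inter> U) \<inter> cbox (z + u *\<^sub>R 1) (z + v *\<^sub>R 1) = \<alpha> \<inter> cbox (z + u *\<^sub>R 1) (z + v *\<^sub>R 1)"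
      using sub[OF True] by auto
    finally show ?thesis using True by simp
  qed simp
  then have "(\<integral>\<^sup>+z. ennreal (real (card (\<alpha> \<inter> cbox (z + u *\<^sub>R 1) (z + v *\<^sub>R 1)))) * indicator K z \<partial>lborel)
      \<le> (\<integral>\<^sup>+z. (\<Sum>a\<in>\<alpha> \<inter> U. ?I z a) \<partial>lborel)"
    by (intro nn_integral_mono) auto
  also have "\<dots> = (\<Sum>a\<in>\<alpha> \<inter> U. ennreal ((v - u) ^ CARD('d)))"
    by (subst nn_integral_sum) (auto simp: nn_integral_moving_cube[OF assms(2)])
  also have "\<dots> = ennreal ((v - u) ^ CARD('d) * real (card (\<alpha> \<inter> U)))"
    using assms(2) by (simp add: ennreal_of_nat_eq_real_of_nat ennreal_mult mult.commute)
  finally show ?thesis .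
qed

text \<open>
  Inner regularity of the finite measure with density \<open>g\<close>.
\<close>

lemma inner_regular_set_integral:
  fixes g :: "real ^ 'd \<Rightarrow> real"
  assumes g: "integrable lborel g" "\<And>x. g x \<ge> 0" and U: "U \<in> sets borel" and "\<delta> > 0"
  obtains K where "compact K" "K \<subseteq> U" "(LINT x:U|lborel. g x) - \<delta> < (LINT x:K|lborel. g x)"
proof (cases "(LINT x:U|lborel. g x) > 0")
  case True
  let ?M = "density lborel (\<lambda>x. ennreal (g x))"
  have em: "emeasure ?M A = ennreal (LINT x:A|lborel. g x)" if "A \<in> sets borel" for A
  proof -
    have "emeasure ?M A = (\<integral>\<^sup>+x. ennreal (indicator A x * g x) \<partial>lborel)"
      using that g by (subst emeasure_density) (auto intro!: nn_integral_cong simp: indicator_def)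
    also have "\<dots> = ennreal (LINT x:A|lborel. g x)"
      unfolding set_lebesgue_integral_def real_scaleR_def
      using that g integrable_mult_indicator[of A lborel g] by (subst nn_integral_eq_integral) auto
    finally show ?thesis .
  qed
  have "ennreal ((LINT x:U|lborel. g x) - \<delta>) < emeasure ?M U"
    using True assms(4) em[OF U] by (simp add: ennreal_lessI)
  also have "emeasure ?M U = (SUP K\<in>{K. K \<subseteq> U \<and> compact K}. emeasure ?M K)"
    using U em[of UNIV] by (intro inner_regular) (auto simp: space_density)
  finally obtain K where K: "K \<subseteq> U" "compact K" "ennreal ((LINT x:U|lborel. g x) - \<delta>) < emeasure ?M K"
    by (auto simp: less_SUP_iff)
  have "ennreal ((LINT x:U|lborel. g x) - \<delta>) < ennreal (LINT x:K|lborel. g x)"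
    using K em[of K] by (simp add: borel_compact)
  then have "(LINT x:U|lborel. g x) - \<delta> < (LINT x:K|lborel. g x)"
    by (meson ennreal_leI not_le)
  with K that show ?thesis by blast
next
  case False
  then show ?thesis using that[of "{}"] assms(4) by (simp add: set_lebesgue_integral_def)
qed

section \<open>Local lower bounds for distortion plus price\<close>

text \<open>
  The trade-off inequality for one cell \<open>S\<close>, to which \<open>v\<close> of \<open>n\<close> points are allotted: on \<open>S\<close> the
  density is at least \<open>\<phi> powr (1 / p)\<close> with \<open>\<phi> = max 0 (y - \<eta>)\<close>. The outcome is linear in \<open>\<phi>\<close> and in
  the volume \<open>h\<^sup>d\<close> of the cell because \<open>(d + r) * p = d\<close>. It is stated with \<open>y - \<eta>\<close>, possibly negative, so
  that \<open>y\<close> can later be integrated.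
\<close>

lemma cell_cost_lower_bound:
  fixes N :: "real ^ 'd \<Rightarrow> real" and f :: "real ^ 'd \<Rightarrow> real"
    and r :: real
  defines "q \<equiv> r / real CARD('d)" and "p \<equiv> real CARD('d) / (real CARD('d) + r)"
  assumes "is_norm N" "r > 0" "\<mu> > 0" "h > 0" "n > 0" "v > 0" "finite \<alpha>" "\<alpha> \<noteq> {}"
    and f: "\<And>x. f x \<ge> 0" "\<And>x. x \<in> S \<Longrightarrow> y - \<eta> \<le> f x powr p"
    and S: "compact S" and F: "integrable lborel (\<lambda>x. f x * set_dist N x \<alpha> powr r)"
    and cell: "J_const N r * h powr (real CARD('d) + r) * v powr - q
        \<le> (LINT x:S|lborel. set_dist N x \<alpha> powr r)"
  shows "(1 + q) * J_const N r powr p * \<mu> powr (1 - p) * (h ^ CARD('d) * (y - \<eta>)) \<le>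
    n powr q * (LINT x:S|lborel. f x * set_dist N x \<alpha> powr r) + q * \<mu> * (v / n)"
proof -
  let ?d = "real CARD('d)"
  define J where "J = J_const N r"
  have J: "J > 0" using J_const_pos[OF assms(3,4)] by (simp add: J_def)
  have q: "q > 0" using assms(4) by (simp add: q_def)
  have p: "p > 0" using assms(4) by (simp add: p_def)
  have pq: "1 / (1 + q) = p" "q / (1 + q) = 1 - p"
    using assms(4) by (auto simp: p_def q_def field_simps)
  define \<phi> where "\<phi> = max 0 (y - \<eta>)"
  have \<phi>: "\<phi> \<ge> 0" by (simp add: \<phi>_def)
  define a where "a = \<phi> powr (1 / p) * (J * h powr (?d + r))"
  have a: "a \<ge> 0" using \<phi> J by (simp add: a_def)
  have "a powr p = \<phi> * J powr p * h powr ((?d + r) * p)"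
    using \<phi> J p by (simp add: a_def powr_mult powr_powr)
  also have "(?d + r) * p = ?d" using assms(4) by (simp add: p_def)
  also have "h powr ?d = h ^ CARD('d)" using assms(6) by (simp add: powr_realpow)
  finally have ap: "a powr p = \<phi> * J powr p * h ^ CARD('d)" .
  have f_ge: "\<phi> powr (1 / p) \<le> f x" if "x \<in> S" for x
  proof -
    have "\<phi> powr (1 / p) \<le> (f x powr p) powr (1 / p)"
      using f(2)[OF that] p by (intro powr_mono2) (auto simp: \<phi>_def)
    then show ?thesis using p f(1)[of x] by (simp add: powr_powr)
  qed
  have "(1 + q) * J powr p * \<mu> powr (1 - p) * (h ^ CARD('d) * (y - \<eta>)) \<le>
      (1 + q) * J powr p * \<mu> powr (1 - p) * (h ^ CARD('d) * \<phi>)"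
    using q assms(6) by (intro mult_left_mono) (auto simp: \<phi>_def)
  also have "\<dots> = (1 + q) * a powr p * \<mu> powr (1 - p)"
    by (simp add: ap mult_ac)
  also have "\<dots> \<le> a * (v / n) powr - q + q * \<mu> * (v / n)"
    using powr_tradeoff_lower_bound[of "q" a \<mu> "v / n"] q a assms(5,7,8) by (simp add: pq)
  also have "a * (v / n) powr - q = n powr q * (\<phi> powr (1 / p) * (J * h powr (?d + r) * v powr - q))"
    using assms(7,8) by (simp add: a_def powr_divide powr_minus field_simps)
  also have "\<dots> \<le> n powr q * (\<phi> powr (1 / p) * (LINT x:S|lborel. set_dist N x \<alpha> powr r))"
    using cell by (intro mult_left_mono) (auto simp: J_def)
  also have "\<phi> powr (1 / p) * (LINT x:S|lborel. set_dist N x \<alpha> powr r) =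
      (LINT x:S|lborel. \<phi> powr (1 / p) * set_dist N x \<alpha> powr r)"
    by simp
  also have "\<dots> \<le> (LINT x:S|lborel. f x * set_dist N x \<alpha> powr r)"
  proof (rule set_integral_mono)
    show "set_integrable lborel S (\<lambda>x. \<phi> powr (1 / p) * set_dist N x \<alpha> powr r)"
      using set_integrable_set_dist_powr[OF assms(3,9,10,4) S] by simp
    show "set_integrable lborel S (\<lambda>x. f x * set_dist N x \<alpha> powr r)"
      unfolding set_integrable_def
      using F S by (intro integrable_mult_indicator) (auto simp: borel_compact)
  qed (use f_ge in \<open>auto intro!: mult_right_mono\<close>)
  finally show ?thesis by (simp add: J_def mult_left_mono)
qed

text \<open>
  The cell bound is integrated over all positions \<open>z \<in> K\<close> of the cell and divided by its volume. Every
  \<open>x \<in> U\<close> is then counted at most once in the distortion, while a point of \<open>\<alpha>\<close> is seen by the larger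
  cubes of side \<open>(1 + 2 * \<tau>) * h\<close>, which costs the factor \<open>(1 + 2 * \<tau>)\<^sup>d\<close>. The last term is the
  contribution of the \<open>M\<close> additional points per cell.
\<close>

lemma averaged_cost_lower_bound:
  fixes N :: "real ^ 'd \<Rightarrow> real" and f :: "real ^ 'd \<Rightarrow> real"
    and r :: real
  defines "q \<equiv> r / real CARD('d)" and "p \<equiv> real CARD('d) / (real CARD('d) + r)"
  assumes N: "is_norm N" and pos: "r > 0" "\<mu> > 0" "h > 0" "n > 0" "M > 0" "\<tau> > 0"
    and \<alpha>: "finite \<alpha>" "\<alpha> \<noteq> {}"
    and f: "\<And>x. f x \<ge> 0" "\<And>z x. z \<in> K \<Longrightarrow> x \<in> cbox z (z + h *\<^sub>R 1) \<Longrightarrow> f z powr p - \<eta> \<le> f x powr p"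
    and K: "compact K" "\<And>z. z \<in> K \<Longrightarrow> cbox (z + (- (\<tau> * h)) *\<^sub>R 1) (z + ((1 + \<tau>) * h) *\<^sub>R 1) \<subseteq> U"
    and U: "U \<in> sets borel"
    and F: "integrable lborel (\<lambda>x. f x * set_dist N x \<alpha> powr r)"
    and g: "integrable lborel (\<lambda>x. f x powr p)"
    and cell: "\<And>z. J_const N r * h powr (real CARD('d) + r) *
        (real (card (\<alpha> \<inter> cbox (z + (- (\<tau> * h)) *\<^sub>R 1) (z + ((1 + \<tau>) * h) *\<^sub>R 1))) + M) powr - q
      \<le> (LINT x:cbox z (z + h *\<^sub>R 1)|lborel. set_dist N x \<alpha> powr r)"
  shows "(1 + q) * J_const N r powr p * \<mu> powr (1 - p) *
      ((LINT z:K|lborel. f z powr p) - \<eta> * measure lborel K) \<le>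
    n powr q * (LINT x:U|lborel. f x * set_dist N x \<alpha> powr r) +
    q * \<mu> * (1 + 2 * \<tau>) ^ CARD('d) * (real (card (\<alpha> \<inter> U)) / n) +
    q * \<mu> * M * measure lborel K / (n * h ^ CARD('d))"
proof -
  let ?d = "real CARD('d)"
  define F where "F = (\<lambda>x. f x * set_dist N x \<alpha> powr r)"
  define T where "T = (\<lambda>z :: real ^ 'd. cbox (z + (- (\<tau> * h)) *\<^sub>R 1) (z + ((1 + \<tau>) * h) *\<^sub>R 1))"
  define C where "C = (\<lambda>z :: real ^ 'd. cbox (z + 0 *\<^sub>R 1) (z + h *\<^sub>R 1))"
  define c where "c = (1 + q) * J_const N r powr p * \<mu> powr (1 - p)"
  define E where "E = (LINT x:U|lborel. F x)"
  define R where "R = n powr q * (h ^ CARD('d) * E) +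
     q * \<mu> / n * (((1 + 2 * \<tau>) * h) ^ CARD('d) * real (card (\<alpha> \<inter> U))) +
     q * \<mu> * M / n * measure lborel K"
  have q: "q > 0" using pos by (simp add: q_def)
  have F_int: "integrable lborel F" using F by (simp add: F_def)
  have F_nonneg: "F x \<ge> 0" for x using f(1) by (simp add: F_def)
  have [measurable]: "F \<in> borel_measurable borel" using F_int by auto
  have [measurable]: "K \<in> sets borel" using K(1) by (rule borel_compact)
  note [measurable] = U
  have K_fin: "emeasure lborel K < \<infinity>" using K(1) by (rule emeasure_compact_finite)
  have CT: "C z \<subseteq> T z" for z
  proof
    fix x assume x: "x \<in> C z"
    have th: "\<tau> * h > 0" using pos by simp
    show "x \<in> T z"
      unfolding T_def mem_box_cart
    proof (intro allI)
      fix i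
      have "z $ i \<le> x $ i" "x $ i \<le> z $ i + h"
        using x by (auto simp: C_def mem_box_cart)
      with th show "(z + (- (\<tau> * h)) *\<^sub>R 1) $ i \<le> x $ i \<and> x $ i \<le> (z + ((1 + \<tau>) * h) *\<^sub>R 1) $ i"
        by (simp add: distrib_right)
    qed
  qed
  have set_int: "integrable lborel (\<lambda>x. indicator A x *\<^sub>R F x)" if "A \<in> sets borel" for A
    using F_int that by (intro integrable_mult_indicator) auto
  have nnF: "(\<integral>\<^sup>+x. ennreal (F x) * indicator A x \<partial>lborel) = ennreal (LINT x:A|lborel. F x)"
    if "A \<in> sets borel" for A
  proof -
    have "(\<integral>\<^sup>+x. ennreal (F x) * indicator A x \<partial>lborel) = (\<integral>\<^sup>+x. ennreal (indicator A x *\<^sub>R F x) \<partial>lborel)"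
      by (intro nn_integral_cong) (auto simp: indicator_def)
    also have "\<dots> = ennreal (LINT x:A|lborel. F x)"
      unfolding set_lebesgue_integral_def
      by (rule nn_integral_eq_integral[OF set_int[OF that]]) (simp add: F_nonneg)
    finally show ?thesis .
  qed
  have LF_nonneg: "(LINT x:A|lborel. F x) \<ge> 0" for A
    unfolding set_lebesgue_integral_def by (intro Bochner_Integration.integral_nonneg) (simp add: F_nonneg)
  have C_sets: "C z \<in> sets borel" for z by (simp add: C_def)
  let ?k = "\<lambda>z. real (card (\<alpha> \<inter> T z))"
  let ?I = "\<lambda>z. indicator K z :: ennreal"
  have pointwise: "c * (h ^ CARD('d) * (f z powr p - \<eta>)) \<le>
      n powr q * (LINT x:C z|lborel. F x) + q * \<mu> / n * ?k z + q * \<mu> * M / n"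
    if z: "z \<in> K" for z
  proof -
    have "c * (h ^ CARD('d) * (f z powr p - \<eta>)) \<le>
        n powr q * (LINT x:C z|lborel. F x) + q * \<mu> * ((?k z + M) / n)"
      unfolding c_def F_def p_def q_def
    proof (rule cell_cost_lower_bound)
      show "f z powr (real CARD('d) / (real CARD('d) + r)) - \<eta> \<le> f x powr (real CARD('d) / (real CARD('d) + r))"
        if "x \<in> C z" for x
        using f(2)[OF z, of x] that by (simp add: C_def p_def)
      show "J_const N r * h powr (real CARD('d) + r) * (?k z + M) powr - (r / real CARD('d))
          \<le> (LINT x:C z|lborel. set_dist N x \<alpha> powr r)"
        using cell[of z] by (simp add: C_def T_def q_def)
    qed (use N pos \<alpha> f F in \<open>auto simp: C_def\<close>)
    then show ?thesis by (simp add: add_divide_distrib distrib_left mult_ac)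
  qed
  have meas_C: "(\<lambda>z. \<integral>\<^sup>+x. ennreal (F x) * indicator (C z) x \<partial>lborel) \<in> borel_measurable borel"
  proof -
    note moving_cube_measurable[of 0 h, measurable]
    show ?thesis unfolding C_def by measurable
  qed
  have meas_k: "(\<lambda>z. ennreal (?k z)) \<in> borel_measurable borel"
    unfolding T_def by (rule card_in_moving_cube_measurable[OF \<alpha>(1)])
  note [measurable] = meas_C meas_k
  have ennreal_split: "ennreal (a1 * a2 + b1 * b2 + m) = ennreal a1 * ennreal a2 + ennreal b1 * ennreal b2 + ennreal m"
    if "a1 \<ge> 0" "a2 \<ge> 0" "b1 \<ge> 0" "b2 \<ge> 0" "m \<ge> 0" for a1 a2 b1 b2 m
    using that by (simp add: ennreal_mult ennreal_plus)
  have "(\<integral>\<^sup>+z. ennreal (indicator K z *\<^sub>R (c * (h ^ CARD('d) * (f z powr p - \<eta>)))) \<partial>lborel) \<le>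
      (\<integral>\<^sup>+z. ennreal (n powr q) * ((\<integral>\<^sup>+x. ennreal (F x) * indicator (C z) x \<partial>lborel) * ?I z) +
        ennreal (q * \<mu> / n) * (ennreal (?k z) * ?I z) + ennreal (q * \<mu> * M / n) * ?I z \<partial>lborel)"
  proof (rule nn_integral_mono)
    fix z
    show "ennreal (indicator K z *\<^sub>R (c * (h ^ CARD('d) * (f z powr p - \<eta>)))) \<le>
       ennreal (n powr q) * ((\<integral>\<^sup>+x. ennreal (F x) * indicator (C z) x \<partial>lborel) * ?I z) +
        ennreal (q * \<mu> / n) * (ennreal (?k z) * ?I z) + ennreal (q * \<mu> * M / n) * ?I z"
    proof (cases "z \<in> K")
      case True
      have "ennreal (n powr q * (LINT x:C z|lborel. F x) + q * \<mu> / n * ?k z + q * \<mu> * M / n) =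
          ennreal (n powr q) * ennreal (LINT x:C z|lborel. F x) + ennreal (q * \<mu> / n) * ennreal (?k z) +
          ennreal (q * \<mu> * M / n)"
        using pos q LF_nonneg[of "C z"] by (intro ennreal_split) auto
      with True ennreal_leI[OF pointwise[OF True]] show ?thesis
        by (simp only: nnF[OF C_sets] indicator_simps mult_1_right scaleR_one)
    qed simp
  qed
  also have "\<dots> = ennreal (n powr q) * (\<integral>\<^sup>+z. (\<integral>\<^sup>+x. ennreal (F x) * indicator (C z) x \<partial>lborel) * ?I z \<partial>lborel) +
        ennreal (q * \<mu> / n) * (\<integral>\<^sup>+z. ennreal (?k z) * ?I z \<partial>lborel) + ennreal (q * \<mu> * M / n) * emeasure lborel K"
    by (simp add: nn_integral_add nn_integral_cmult)
  also have "\<dots> \<le> ennreal (n powr q) * (ennreal (h ^ CARD('d)) * ennreal E) +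
     ennreal (q * \<mu> / n) * ennreal (((1 + 2 * \<tau>) * h) ^ CARD('d) * real (card (\<alpha> \<inter> U))) +
     ennreal (q * \<mu> * M / n) * ennreal (measure lborel K)"
  proof (intro add_mono mult_left_mono)
    show "(\<integral>\<^sup>+z. (\<integral>\<^sup>+x. ennreal (F x) * indicator (C z) x \<partial>lborel) * ?I z \<partial>lborel) \<le>
        ennreal (h ^ CARD('d)) * ennreal E"
      using nn_integral_average_over_cubes_le[of "\<lambda>x. ennreal (F x)" K U 0 h] CT K(2) pos
      unfolding E_def nnF[OF U, symmetric] C_def T_def by fastforce
    show "(\<integral>\<^sup>+z. ennreal (?k z) * ?I z \<partial>lborel) \<le> ennreal (((1 + 2 * \<tau>) * h) ^ CARD('d) * real (card (\<alpha> \<inter> U)))"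
    proof -
      have "- (\<tau> * h) \<le> (1 + \<tau>) * h" "(1 + \<tau>) * h - - (\<tau> * h) = (1 + 2 * \<tau>) * h"
        using pos by (auto simp: algebra_simps intro: add_increasing)
      then show ?thesis
        using nn_integral_count_in_cubes_le[of K "- (\<tau> * h)" "(1 + \<tau>) * h" \<alpha> U] K(2) \<alpha>
        unfolding T_def by simp
    qed
    show "emeasure lborel K \<le> ennreal (measure lborel K)"
      using K_fin by (simp add: emeasure_eq_ennreal_measure)
  qed auto
  also have "\<dots> = ennreal R"
  proof -
    have 1: "ennreal (h ^ CARD('d) * E) = ennreal (h ^ CARD('d)) * ennreal E"
      by (rule ennreal_mult) (use pos LF_nonneg[of U] in \<open>auto simp: E_def\<close>)
    have 2: "ennreal (q * \<mu> * M / n * measure lborel K) =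
        ennreal (q * \<mu> * M / n) * ennreal (measure lborel K)"
      by (rule ennreal_mult) (use pos q in auto)
    show ?thesis
      unfolding R_def 1[symmetric] 2[symmetric] using pos q LF_nonneg[of U]
      by (intro ennreal_split[symmetric]) (auto simp: E_def)
  qed
  finally have nn: "(\<integral>\<^sup>+z. ennreal (indicator K z *\<^sub>R (c * (h ^ CARD('d) * (f z powr p - \<eta>)))) \<partial>lborel) \<le> ennreal R" .
  have R: "R \<ge> 0"
    using pos q LF_nonneg[of U] by (auto simp: R_def E_def)
  have "(LINT z|lborel. indicator K z *\<^sub>R (c * (h ^ CARD('d) * (f z powr p - \<eta>)))) \<le> R"
    by (rule integral_real_bounded[OF R nn])
  also have "(LINT z|lborel. indicator K z *\<^sub>R (c * (h ^ CARD('d) * (f z powr p - \<eta>)))) =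
     (LINT z|lborel. c * h ^ CARD('d) * (indicator K z *\<^sub>R f z powr p - \<eta> * indicator K z))"
    by (intro Bochner_Integration.integral_cong) (auto simp: algebra_simps)
  also have "\<dots> = c * h ^ CARD('d) * ((LINT z:K|lborel. f z powr p) - \<eta> * measure lborel K)"
    using integrable_mult_indicator[OF _ g, of K] K_fin
    by (simp add: set_lebesgue_integral_def)
  finally have "c * h ^ CARD('d) * ((LINT z:K|lborel. f z powr p) - \<eta> * measure lborel K) / h ^ CARD('d) \<le>
      R / h ^ CARD('d)"
    by (rule divide_right_mono) (use pos in auto)
  also have "R / h ^ CARD('d) = n powr q * E + q * \<mu> * (1 + 2 * \<tau>) ^ CARD('d) * (real (card (\<alpha> \<inter> U)) / n) +
    q * \<mu> * M * measure lborel K / (n * h ^ CARD('d))"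
    using pos by (simp add: R_def add_divide_distrib power_mult_distrib)
  finally show ?thesis
    using pos by (simp add: c_def E_def F_def)
qed

lemma norm_diff_cube_le:
  fixes x z :: "real ^ 'd"
  assumes "x \<in> cbox (z + u *\<^sub>R 1) (z + v *\<^sub>R 1)" "- w \<le> u" "v \<le> w"
  shows "norm (x - z) \<le> real CARD('d) * w"
proof -
  have "\<bar>(x - z) $ i\<bar> \<le> w" for i
  proof -
    have "z $ i + u \<le> x $ i" "x $ i \<le> z $ i + v"
      using assms(1) by (auto simp: mem_box_cart)
    with assms(2,3) show ?thesis by simp
  qed
  then have "(\<Sum>i\<in>UNIV. \<bar>(x - z) $ i\<bar>) \<le> of_nat (card (UNIV :: 'd set)) * w"
    by (intro sum_bounded_above)
  with norm_le_l1_cart[of "x - z"] show ?thesis by simp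
qed

text \<open>
  The parameters of the averaged bound are chosen in the order \<open>\<tau>\<close>, \<open>K\<close>, \<open>\<eta>\<close>, \<open>h\<close>, \<open>n\<close>. Each of the
  margin, the part of \<open>U\<close> outside \<open>K\<close>, the oscillation of \<open>f powr p\<close> on a cell, and the additional
  points costs at most \<open>\<epsilon> / 4\<close>.
\<close>

lemma eventually_local_cost_ge:
  fixes N :: "real ^ 'd \<Rightarrow> real" and f :: "real ^ 'd \<Rightarrow> real"
    and r :: real
  defines "q \<equiv> r / real CARD('d)" and "p \<equiv> real CARD('d) / (real CARD('d) + r)"
  assumes N: "is_norm N" and r: "r > 0" and \<mu>: "\<mu> > 0"
    and f: "\<And>x. f x \<ge> 0" "continuous_on UNIV f"
    and F: "\<forall>n\<ge>1. integrable lborel (\<lambda>x. f x * set_dist N x (\<alpha> n) powr r)"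
    and g: "integrable lborel (\<lambda>x. f x powr p)"
    and \<alpha>: "quantizer_seq \<alpha>" and U: "open U" and \<epsilon>: "\<epsilon> > 0"
  shows "\<forall>\<^sub>F n in sequentially.
    (1 + q) * J_const N r powr p * \<mu> powr (1 - p) * (LINT x:U|lborel. f x powr p) - \<epsilon> \<le>
    real n powr q * (LINT x:U|lborel. f x * set_dist N x (\<alpha> n) powr r) +
    q * \<mu> * (real (card (\<alpha> n \<inter> U)) / real n)"
proof -
  let ?d = "real CARD('d)"
  define c where "c = (1 + q) * J_const N r powr p * \<mu> powr (1 - p)"
  define e where "e = \<epsilon> / 4"
  have e: "e > 0" using \<epsilon> by (simp add: e_def)
  have q: "q > 0" using r by (simp add: q_def)
  have p: "p > 0" using r by (simp add: p_def)
  have c: "c > 0" using J_const_pos[OF N r] q \<mu> by (simp add: c_def)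
  have "((\<lambda>\<tau>. q * \<mu> * ((1 + 2 * \<tau>) ^ CARD('d) - 1)) \<longlongrightarrow> q * \<mu> * ((1 + 2 * 0) ^ CARD('d) - 1)) (at_right 0)"
    by (intro tendsto_intros)
  then have "\<forall>\<^sub>F \<tau> in at_right 0. q * \<mu> * ((1 + 2 * \<tau>) ^ CARD('d) - 1) < e"
    using e by (intro order_tendstoD) auto
  then have "\<forall>\<^sub>F \<tau> in at_right 0. q * \<mu> * ((1 + 2 * \<tau>) ^ CARD('d) - 1) < e \<and> \<tau> > 0"
    using eventually_at_right_less[of "0 :: real"] by eventually_elim simp
  then obtain \<tau> where \<tau>: "q * \<mu> * ((1 + 2 * \<tau>) ^ CARD('d) - 1) < e" "\<tau> > 0"
    using eventually_happens trivial_limit_at_right_real by blast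
  obtain M where M: "M > 0"
    "\<And>z h \<alpha>. h > 0 \<Longrightarrow> finite \<alpha> \<Longrightarrow> \<alpha> \<noteq> {} \<Longrightarrow>
      J_const N r * h powr (?d + r) *
        (real (card (\<alpha> \<inter> cbox (z + (- (\<tau> * h)) *\<^sub>R 1) (z + ((1 + \<tau>) * h) *\<^sub>R 1))) + M) powr - (r / ?d)
      \<le> (LINT x:cbox z (z + h *\<^sub>R 1)|lborel. set_dist N x \<alpha> powr r)"
    using cell_distortion_lower_bound[OF N r \<tau>(2)] by blast
  obtain K where K: "compact K" "K \<subseteq> U"
    "(LINT x:U|lborel. f x powr p) - e / c < (LINT x:K|lborel. f x powr p)"
    using inner_regular_set_integral[OF g _ borel_open[OF U], of "e / c"] e c by auto
  \<comment> \<open>the summand \<open>1\<close> only guards against a null set \<open>K\<close>\<close>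
  define \<eta> where "\<eta> = e / (c * (measure lborel K + 1))"
  have K1: "measure lborel K + 1 > 0" by (simp add: add_nonneg_pos)
  have \<eta>: "\<eta> > 0" using e c K1 by (simp add: \<eta>_def)
  have "c * (\<eta> * measure lborel K) = e * (measure lborel K / (measure lborel K + 1))"
    using c by (simp add: \<eta>_def)
  also have "\<dots> \<le> e * 1"
    using e K1 by (intro mult_left_mono) auto
  finally have \<eta>K: "c * (\<eta> * measure lborel K) \<le> e" by simp
  obtain \<delta>1 where \<delta>1: "\<delta>1 > 0" "(\<Union>x\<in>K. ball x \<delta>1) \<subseteq> U"
    using compact_subset_open_imp_ball_epsilon_subset[OF K(1) U K(2)] by blast
  obtain R where R: "\<And>x. x \<in> K \<Longrightarrow> norm x \<le> R"
    using compact_imp_bounded[OF K(1)] by (auto simp: bounded_iff)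
  \<comment> \<open>cells placed at points of \<open>K\<close> may stick out of \<open>K\<close>, hence uniform continuity on a larger ball\<close>
  have "continuous_on (cball 0 (R + 1)) (\<lambda>x. f x powr p)"
    using f p by (intro continuous_on_powr' continuous_on_subset[OF f(2)] continuous_on_const) auto
  then have "uniformly_continuous_on (cball 0 (R + 1)) (\<lambda>x. f x powr p)"
    by (intro compact_uniformly_continuous) auto
  then obtain \<delta>2 where \<delta>2: "\<delta>2 > 0"
    "\<And>x y. x \<in> cball 0 (R + 1) \<Longrightarrow> y \<in> cball 0 (R + 1) \<Longrightarrow> dist y x < \<delta>2 \<Longrightarrow>
        dist (f y powr p) (f x powr p) < \<eta>"
    unfolding uniformly_continuous_on_def using \<eta> by metis
  define \<delta> where "\<delta> = min 1 (min \<delta>1 \<delta>2)"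
  have \<delta>: "\<delta> > 0" using \<delta>1 \<delta>2 by (simp add: \<delta>_def)
  define h where "h = \<delta> / (2 * ?d * (1 + \<tau>))"
  have h: "h > 0" using \<delta> \<tau> by (simp add: h_def)
  have "?d * ((1 + \<tau>) * h) = \<delta> / 2" using \<tau> by (simp add: h_def)
  then have h\<delta>: "?d * ((1 + \<tau>) * h) < \<delta>" using \<delta> by simp
  have T_near: "norm (x - z) < \<delta>"
    if "x \<in> cbox (z + (- (\<tau> * h)) *\<^sub>R 1) (z + ((1 + \<tau>) * h) *\<^sub>R 1)" for x z :: "real ^ 'd"
    using norm_diff_cube_le[OF that, of "(1 + \<tau>) * h"] h h\<delta> by (simp add: algebra_simps)
  have C_near: "norm (x - z) < \<delta>" if "x \<in> cbox z (z + h *\<^sub>R 1)" for x z :: "real ^ 'd"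
  proof -
    have "- ((1 + \<tau>) * h) \<le> 0" "h \<le> (1 + \<tau>) * h" using h \<tau> by auto
    then show ?thesis
      using norm_diff_cube_le[of x z 0 h "(1 + \<tau>) * h"] that h\<delta> by simp
  qed
  have T_sub: "cbox (z + (- (\<tau> * h)) *\<^sub>R 1) (z + ((1 + \<tau>) * h) *\<^sub>R 1) \<subseteq> U" if z: "z \<in> K" for z
  proof
    fix x assume "x \<in> cbox (z + (- (\<tau> * h)) *\<^sub>R 1) (z + ((1 + \<tau>) * h) *\<^sub>R 1)"
    then have "x \<in> ball z \<delta>1"
      using T_near[of x z] by (simp add: dist_norm norm_minus_commute \<delta>_def)
    with z \<delta>1(2) show "x \<in> U" by blast
  qed
  have osc: "f z powr p - \<eta> \<le> f x powr p" if "z \<in> K" "x \<in> cbox z (z + h *\<^sub>R 1)" for z x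
  proof -
    have "norm x \<le> norm (x - z) + norm z" by norm
    then have "dist (f x powr p) (f z powr p) < \<eta>"
      using C_near[OF that(2)] R[OF that(1)]
      by (intro \<delta>2(2)) (auto simp: dist_norm \<delta>_def)
    then show ?thesis by (simp add: dist_real_def)
  qed
  have "((\<lambda>n. q * \<mu> * M * measure lborel K / h ^ CARD('d) * (1 / real n)) \<longlonglongrightarrow>
      q * \<mu> * M * measure lborel K / h ^ CARD('d) * 0)"
    by (intro tendsto_intros lim_1_over_n)
  then have "\<forall>\<^sub>F n in sequentially. q * \<mu> * M * measure lborel K / h ^ CARD('d) * (1 / real n) < e"
    using e by (intro order_tendstoD) auto
  then show ?thesis
    using eventually_ge_at_top[of 1]
  proof eventually_elim
    case (elim n)
    have \<alpha>n: "finite (\<alpha> n)" "\<alpha> n \<noteq> {}" "card (\<alpha> n) \<le> n"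
      using \<alpha> elim by (auto simp: quantizer_seq_def)
    define v where "v = real (card (\<alpha> n \<inter> U)) / real n"
    define E where "E = real n powr q * (LINT x:U|lborel. f x * set_dist N x (\<alpha> n) powr r)"
    have "card (\<alpha> n \<inter> U) \<le> n"
      using card_mono[OF \<alpha>n(1), of "\<alpha> n \<inter> U"] \<alpha>n(3) by simp
    then have v: "v \<le> 1" "v \<ge> 0" using elim by (auto simp: v_def)
    have "c * ((LINT x:K|lborel. f x powr p) - \<eta> * measure lborel K) \<le>
      E + q * \<mu> * (1 + 2 * \<tau>) ^ CARD('d) * v + q * \<mu> * M * measure lborel K / (real n * h ^ CARD('d))"
      unfolding c_def E_def v_def q_def p_def
      using elim \<mu> h M \<tau> \<alpha>n r
      by (intro averaged_cost_lower_bound[OF N, where \<tau> = \<tau> and h = h and M = M and K = K]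
           osc[unfolded p_def] f(1) K(1) T_sub borel_open[OF U] F[rule_format] g[unfolded p_def] M(2)) auto
    also have "q * \<mu> * M * measure lborel K / (real n * h ^ CARD('d)) \<le> e"
      using elim by (simp add: field_simps)
    also have "q * \<mu> * (1 + 2 * \<tau>) ^ CARD('d) * v = q * \<mu> * v + q * \<mu> * ((1 + 2 * \<tau>) ^ CARD('d) - 1) * v"
      by (simp add: algebra_simps)
    also have "q * \<mu> * ((1 + 2 * \<tau>) ^ CARD('d) - 1) * v \<le> e * 1"
      using v \<tau> e by (intro mult_mono) auto
    finally have "c * (LINT x:K|lborel. f x powr p) \<le> E + q * \<mu> * v + 3 * e"
      using \<eta>K by (simp add: algebra_simps)
    moreover have "c * ((LINT x:U|lborel. f x powr p) - e / c) \<le> c * (LINT x:K|lborel. f x powr p)"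
      using K(3) c by (intro mult_left_mono) auto
    ultimately have "c * (LINT x:U|lborel. f x powr p) - 4 * e \<le> E + q * \<mu> * v"
      using c by (simp add: algebra_simps)
    then show ?case
      by (simp add: c_def E_def v_def e_def)
  qed
qed

section \<open>The empirical measure theorem\<close>

text \<open>
  An optimal sequence leaves no room for slack in the local lower bounds. Varying the price \<open>\<mu>\<close> on \<open>B\<close>
  around the critical value \<open>Q\<close>, with the price \<open>Q\<close> kept outside \<open>B\<close>, recovers the share of points in \<open>B\<close>
  as the derivative of the optimal cost with respect to the price.
\<close>

lemma empirical_measure_convergence:
  fixes N :: "real ^ 'd \<Rightarrow> real" and f :: "real ^ 'd \<Rightarrow> real"
    and r :: real
  defines "p \<equiv> real CARD('d) / (real CARD('d) + r)"
  assumes N: "is_norm N" and r: "r > 0"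
    and f: "\<And>x. f x \<ge> 0" "continuous_on UNIV f"
    and F: "\<forall>n\<ge>1. integrable lborel (\<lambda>x. f x * set_dist N x (\<alpha> n) powr r)"
    and g: "integrable lborel (\<lambda>x. f x powr p)"
    and C_pos: "(LINT x|lborel. f x powr p) > 0"
    and opt: "asymp_optimal N r f \<alpha>"
    and B: "B \<in> sets borel" "emeasure lborel (frontier B) = 0"
  shows "(\<lambda>n. real (card (\<alpha> n \<inter> B)) / real n) \<longlonglongrightarrow>
    (LINT x:B|lborel. f x powr p) / (LINT x|lborel. f x powr p)"
proof -
  define q where "q = r / real CARD('d)"
  define J where "J = J_const N r"
  define C where "C = (LINT x|lborel. f x powr p)"
  define G where "G = (LINT x:B|lborel. f x powr p)"
  define Q where "Q = J * C powr (1 / p)"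
  define c where "c = (\<lambda>\<mu>. (1 + q) * J powr p * \<mu> powr (1 - p))"
  define v where "v = (\<lambda>n. real (card (\<alpha> n \<inter> B)) / real n)"
  have q: "q > 0" using r by (simp add: q_def)
  have p: "p > 0" using r by (simp add: p_def)
  have pq: "(1 + q) * (1 - p) = q"
  proof -
    have "1 + q = (real CARD('d) + r) / real CARD('d)" by (simp add: q_def field_simps)
    then have "(1 + q) * p = 1" using r by (simp add: p_def)
    then show ?thesis by (simp add: right_diff_distrib)
  qed
  have J: "J > 0" using J_const_pos[OF N r] by (simp add: J_def)
  have C: "C > 0" using C_pos by (simp add: C_def)
  have Q: "Q > 0" using J C by (simp add: Q_def)
  have Qp: "Q powr p = J powr p * C"
    using C p J by (simp add: Q_def powr_mult powr_powr)
  have \<alpha>: "quantizer_seq \<alpha>" using opt by (simp add: asymp_optimal_def)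
  have Q_eq: "Q_const N r f = Q"
    by (simp add: Q_const_def Q_def J_def C_def p_def)
  \<comment> \<open>at the price \<open>Q\<close>, the local bound for the whole space is attained\<close>
  have cQ: "c Q * C = Q + q * Q"
  proof -
    have "c Q * C = (1 + q) * (Q powr p * Q powr (1 - p))"
      unfolding Qp c_def by simp
    also have "\<dots> = (1 + q) * Q" using Q by (simp flip: powr_add)
    finally show ?thesis by (simp add: algebra_simps)
  qed
  have c_deriv: "((\<lambda>\<mu>. (c \<mu> - c Q) / (\<mu> - Q) * (G / q)) \<longlongrightarrow> G / C) (at Q)"
  proof -
    have "(c has_real_derivative (1 + q) * J powr p * ((1 - p) * Q powr (1 - p - 1))) (at Q)"
      unfolding c_def using Q by (intro DERIV_cmult has_real_derivative_powr)
    also have "(1 + q) * J powr p * ((1 - p) * Q powr (1 - p - 1)) =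
        ((1 + q) * (1 - p)) * (J powr p * Q powr (- p))"
      by simp
    also have "\<dots> = q / C"
      unfolding pq powr_minus Qp using J C by (simp add: field_simps)
    finally have "((\<lambda>\<mu>. (c \<mu> - c Q) / (\<mu> - Q)) \<longlongrightarrow> q / C) (at Q)"
      by (simp add: has_field_derivative_iff)
    then have "((\<lambda>\<mu>. (c \<mu> - c Q) / (\<mu> - Q) * (G / q)) \<longlongrightarrow> q / C * (G / q)) (at Q)"
      by (intro tendsto_mult tendsto_const)
    then show ?thesis using q by simp
  qed

  define U where "U = interior B"
  define V where "V = - closure B"
  have UV: "open U" "open V" "U \<subseteq> B" "V \<subseteq> - B" "U \<inter> V = {}"
    using interior_subset[of B] closure_subset[of B] by (auto simp: U_def V_def)
  have g_set: "integrable lborel (\<lambda>x. indicator A x *\<^sub>R f x powr p)" if "A \<in> sets borel" for A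
    using g that by (intro integrable_mult_indicator) auto
  have AE: "AE x in lborel. x \<notin> frontier B"
    using B(2) by (intro AE_not_in) (auto simp: null_sets_def)
  have GU: "(LINT x:U|lborel. f x powr p) = G"
    unfolding G_def set_lebesgue_integral_def
    using AE g_set[of B] g_set[of U] UV B(1)
    by (intro integral_cong_AE)
       (auto simp: indicator_def U_def frontier_def closure_def elim!: eventually_mono
             dest: interior_subset[THEN subsetD] closure_subset[THEN subsetD])
  have GV: "(LINT x:V|lborel. f x powr p) = C - G"
  proof -
    have "(LINT x:V|lborel. f x powr p) = (LINT x|lborel. f x powr p - indicator B x *\<^sub>R f x powr p)"
      unfolding set_lebesgue_integral_def
      using AE g_set[of B] g_set[of V] UV B(1) g
      by (intro integral_cong_AE)
         (auto simp: indicator_def V_def frontier_def elim!: eventually_mono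
               dest: interior_subset[THEN subsetD] closure_subset[THEN subsetD])
    also have "\<dots> = C - G"
      unfolding G_def C_def set_lebesgue_integral_def
      by (rule Bochner_Integration.integral_diff[OF g g_set[OF B(1)]])
    finally show ?thesis .
  qed

  have opt_lim: "(\<lambda>n. real n powr q * (LINT x|lborel. f x * set_dist N x (\<alpha> n) powr r)) \<longlonglongrightarrow> Q"
  proof (rule Lim_transform_eventually)
    show "(\<lambda>n. real n powr q * distortion N r (density lborel (\<lambda>x. ennreal (f x))) (\<alpha> n)) \<longlonglongrightarrow> Q"
      using opt by (simp add: asymp_optimal_def Q_eq q_def)
    show "\<forall>\<^sub>F n in sequentially. real n powr q * distortion N r (density lborel (\<lambda>x. ennreal (f x))) (\<alpha> n) =
        real n powr q * (LINT x|lborel. f x * set_dist N x (\<alpha> n) powr r)"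
      using eventually_ge_at_top[of 1]
    proof eventually_elim
      case (elim n)
      then have "finite (\<alpha> n)" "\<alpha> n \<noteq> {}" using \<alpha> by (auto simp: quantizer_seq_def)
      then show ?case
        unfolding distortion_def using f(1) borel_measurable_continuous_onI[OF f(2)] N r
        by (subst integral_density) (auto intro: set_dist_powr_measurable)
    qed
  qed

  \<comment> \<open>Only the term \<open>q * (\<mu> - Q) * v n\<close> survives because the points of \<open>B\<close> and of its exterior
     together number at most \<open>n\<close>, and \<open>c Q * C\<close> cancels \<open>Q + q * Q\<close>.\<close>
  have key: "\<forall>\<^sub>F n in sequentially. (c \<mu> - c Q) * G - \<epsilon> \<le> q * (\<mu> - Q) * v n"
    if \<mu>: "\<mu> > 0" and \<epsilon>: "\<epsilon> > 0" for \<mu> \<epsilon>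
  proof -
    have e: "\<epsilon> / 3 > 0" using \<epsilon> by simp
    note 1 = eventually_local_cost_ge[OF N r \<mu> f F g[unfolded p_def] \<alpha> UV(1) e]
    note 2 = eventually_local_cost_ge[OF N r Q f F g[unfolded p_def] \<alpha> UV(2) e]
    have 3: "\<forall>\<^sub>F n in sequentially. real n powr q * (LINT x|lborel. f x * set_dist N x (\<alpha> n) powr r) < Q + \<epsilon> / 3"
      using opt_lim e by (intro order_tendstoD) auto
    from 1 2 3 eventually_ge_at_top[of 1] show ?thesis
      unfolding p_def[symmetric] q_def[symmetric] J_def[symmetric] GU GV
    proof eventually_elim
      case (elim n)
      have \<alpha>n: "finite (\<alpha> n)" "\<alpha> n \<noteq> {}" "card (\<alpha> n) \<le> n"
        using \<alpha> elim by (auto simp: quantizer_seq_def)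
      define F' where "F' = (\<lambda>x. f x * set_dist N x (\<alpha> n) powr r)"
      have F': "integrable lborel F'" "\<And>x. F' x \<ge> 0"
        using F elim f(1) by (auto simp: F'_def)
      have F'_set: "integrable lborel (\<lambda>x. indicator A x *\<^sub>R F' x)" if "A \<in> sets borel" for A
        using F' that by (intro integrable_mult_indicator) auto
      have "(LINT x:U|lborel. F' x) + (LINT x:V|lborel. F' x) =
          (LINT x|lborel. indicator U x *\<^sub>R F' x + indicator V x *\<^sub>R F' x)"
        unfolding set_lebesgue_integral_def
        using UV by (intro Bochner_Integration.integral_add[symmetric] F'_set) auto
      also have "\<dots> \<le> (LINT x|lborel. F' x)"
        using UV F' by (intro integral_mono Bochner_Integration.integrable_add F'_set)
          (auto simp: indicator_def)
      finally have "real n powr q * ((LINT x:U|lborel. F' x) + (LINT x:V|lborel. F' x)) \<le>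
          real n powr q * (LINT x|lborel. F' x)"
        by (rule mult_left_mono) simp
      then have cost: "real n powr q * (LINT x:U|lborel. F' x) + real n powr q * (LINT x:V|lborel. F' x) \<le> Q + \<epsilon> / 3"
        using elim by (simp add: F'_def distrib_left)
      have "card (\<alpha> n \<inter> U) \<le> card (\<alpha> n \<inter> B)"
        using UV \<alpha>n by (intro card_mono) auto
      then have vU: "real (card (\<alpha> n \<inter> U)) / real n \<le> v n"
        using elim by (simp add: v_def divide_right_mono)
      have "card (\<alpha> n \<inter> V) + card (\<alpha> n \<inter> B) = card ((\<alpha> n \<inter> V) \<union> (\<alpha> n \<inter> B))"
        using UV \<alpha>n by (intro card_Un_disjoint[symmetric]) auto
      also have "\<dots> \<le> card (\<alpha> n)" using \<alpha>n by (intro card_mono) auto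
      finally have "real (card (\<alpha> n \<inter> V)) + real (card (\<alpha> n \<inter> B)) \<le> real n"
        using \<alpha>n(3) by linarith
      then have vV: "real (card (\<alpha> n \<inter> V)) / real n \<le> 1 - v n"
        using elim by (simp add: v_def field_simps)
      have "c \<mu> * G - \<epsilon> / 3 + (c Q * (C - G) - \<epsilon> / 3) \<le>
          (Q + \<epsilon> / 3) + q * \<mu> * (real (card (\<alpha> n \<inter> U)) / real n) + q * Q * (real (card (\<alpha> n \<inter> V)) / real n)"
        using elim cost unfolding c_def F'_def by linarith
      also have "\<dots> \<le> (Q + \<epsilon> / 3) + q * \<mu> * v n + q * Q * (1 - v n)"
        using vU vV q \<mu> Q by (intro add_mono mult_left_mono) auto
      finally show ?case
        using cQ by (simp add: algebra_simps)
    qed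
  qed

  show ?thesis
    unfolding G_def[symmetric] C_def[symmetric] v_def[symmetric]
  proof (rule order_tendstoI)
    fix a assume a: "a < G / C"
    have "\<forall>\<^sub>F \<mu> in at_right Q. a < (c \<mu> - c Q) / (\<mu> - Q) * (G / q)"
      using order_tendstoD(1)[OF c_deriv a] by (rule filter_leD[OF at_le, rotated]) simp
    then have "\<forall>\<^sub>F \<mu> in at_right Q. a < (c \<mu> - c Q) / (\<mu> - Q) * (G / q) \<and> Q < \<mu>"
      using eventually_at_right_less[of Q] by eventually_elim simp
    then obtain \<mu> where \<mu>: "a < (c \<mu> - c Q) / (\<mu> - Q) * (G / q)" "Q < \<mu>"
      using eventually_happens trivial_limit_at_right_real by blast
    define w where "w = q * (\<mu> - Q)"
    have w: "w > 0" using \<mu> q by (simp add: w_def)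
    have aw: "a * w < (c \<mu> - c Q) * G"
      using \<mu> q by (simp add: w_def field_simps)
    define \<epsilon> where "\<epsilon> = ((c \<mu> - c Q) * G - a * w) / 2"
    have \<epsilon>: "\<epsilon> > 0" using aw by (simp add: \<epsilon>_def)
    have "\<mu> > 0" using \<mu> Q by simp
    from key[OF this \<epsilon>] show "\<forall>\<^sub>F n in sequentially. a < v n"
    proof eventually_elim
      case (elim n)
      have "a * w < (c \<mu> - c Q) * G - \<epsilon>" using aw by (simp add: \<epsilon>_def field_simps)
      also have "\<dots> \<le> v n * w" using elim by (simp add: w_def mult_ac)
      finally show ?case using w by simp
    qed
  next
    fix a assume a: "G / C < a"
    have "\<forall>\<^sub>F \<mu> in at_left Q. (c \<mu> - c Q) / (\<mu> - Q) * (G / q) < a"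
      using order_tendstoD(2)[OF c_deriv a] by (rule filter_leD[OF at_le, rotated]) simp
    then have "\<forall>\<^sub>F \<mu> in at_left Q. (c \<mu> - c Q) / (\<mu> - Q) * (G / q) < a \<and> \<mu> \<in> {0<..<Q}"
      using eventually_at_left_real[OF Q] by eventually_elim simp
    then obtain \<mu> where \<mu>: "(c \<mu> - c Q) / (\<mu> - Q) * (G / q) < a" "0 < \<mu>" "\<mu> < Q"
      using eventually_happens trivial_limit_at_left_real by fastforce
    define w where "w = q * (Q - \<mu>)"
    have w: "w > 0" using \<mu> q by (simp add: w_def)
    have eq: "(c \<mu> - c Q) / (\<mu> - Q) * (G / q) = (c Q - c \<mu>) * G / w"
      using \<mu> q by (simp add: w_def divide_simps) (simp add: algebra_simps)
    have aw: "(c Q - c \<mu>) * G < a * w"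
      using \<mu>(1) w unfolding eq by (simp add: pos_divide_less_eq)
    define \<epsilon> where "\<epsilon> = (a * w - (c Q - c \<mu>) * G) / 2"
    have \<epsilon>: "\<epsilon> > 0" using aw by (simp add: \<epsilon>_def)
    from key[OF \<mu>(2) \<epsilon>] show "\<forall>\<^sub>F n in sequentially. v n < a"
    proof eventually_elim
      case (elim n)
      have "v n * w \<le> (c Q - c \<mu>) * G + \<epsilon>" using elim by (simp add: w_def algebra_simps)
      also have "\<dots> < a * w" using aw by (simp add: \<epsilon>_def field_simps)
      finally show ?case using w by simp
    qed
  qed
qed

section \<open>Gaussian densities\<close>

lemma pos_def_det_nz:
  fixes A :: "real ^ 'd ^ 'd"
  assumes "\<And>x. x \<noteq> 0 \<Longrightarrow> x \<bullet> (A *v x) > 0"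
  shows "det A \<noteq> 0"
proof -
  have "x = 0" if "A *v x = 0" for x
    using assms[of x] that by auto
  then have "\<exists>B. B ** A = mat 1"
    unfolding matrix_left_invertible_ker by blast
  then show ?thesis
    by (simp add: invertible_det_nz[symmetric] invertible_left_inverse)
qed

text \<open>
  The segment from the identity matrix to \<open>S\<close> consists of nonsingular matrices, so the determinant
  keeps the sign that it has at the identity.
\<close>

lemma pos_def_det_pos:
  fixes S :: "real ^ 'd ^ 'd"
  assumes "pos_def S"
  shows "det S > 0"
proof (rule ccontr)
  assume neg: "\<not> det S > 0"
  define A where "A = (\<lambda>t :: real. (1 - t) *\<^sub>R mat 1 + t *\<^sub>R S)"
  have cont: "continuous_on {0..1} (\<lambda>t. det (A t))"
    unfolding det_def A_def by (intro continuous_intros)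
  have "\<exists>t. 0 \<le> t \<and> t \<le> 1 \<and> det (A t) = 0"
    using neg by (intro IVT2' cont) (auto simp: A_def)
  then obtain t where t: "0 \<le> t" "t \<le> 1" "det (A t) = 0" by blast
  have "x \<bullet> (A t *v x) > 0" if "x \<noteq> 0" for x
  proof -
    have eq: "x \<bullet> (A t *v x) = (1 - t) * (x \<bullet> x) + t * (x \<bullet> (S *v x))"
      by (simp add: A_def matrix_vector_mult_add_rdistrib inner_add_right
          flip: scaleR_matrix_vector_assoc)
    have "x \<bullet> x > 0" "x \<bullet> (S *v x) > 0" using that assms by (auto simp: pos_def_def)
    then show ?thesis
      unfolding eq using t by (cases "t = 0") (auto intro!: add_nonneg_pos)
  qed
  from pos_def_det_nz[OF this] t(3) show False by simp
qed

lemma pos_def_matrix_inv_pos: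
  fixes S :: "real ^ 'd ^ 'd"
  assumes "pos_def S" "x \<noteq> 0"
  shows "x \<bullet> (matrix_inv S *v x) > 0"
proof -
  have "invertible S"
    using pos_def_det_pos[OF assms(1)] by (simp add: invertible_det_nz)
  then have "S ** matrix_inv S = mat 1"
    unfolding invertible_def matrix_inv_def by (rule someI2_ex) simp
  then have x: "S *v (matrix_inv S *v x) = x"
    by (simp add: matrix_vector_mul_assoc)
  then have "matrix_inv S *v x \<noteq> 0" using assms(2) by auto
  then have "(matrix_inv S *v x) \<bullet> (S *v (matrix_inv S *v x)) > 0"
    using assms(1) by (auto simp: pos_def_def)
  then show ?thesis by (simp add: x inner_commute)
qed

text \<open>
  A quadratic form that is positive on the compact unit sphere is bounded below there.
\<close>

lemma pos_def_matrix_inv_lower_bound: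
  fixes S :: "real ^ 'd ^ 'd"
  assumes "pos_def S"
  obtains \<kappa> where "\<kappa> > 0" "\<And>x. \<kappa> * (norm x)\<^sup>2 \<le> x \<bullet> (matrix_inv S *v x)"
proof -
  let ?Q = "\<lambda>x. x \<bullet> (matrix_inv S *v x)"
  have "continuous_on (sphere 0 1) ?Q"
    by (intro continuous_intros)
  then obtain x0 where x0: "x0 \<in> sphere 0 1" "\<And>x. x \<in> sphere 0 1 \<Longrightarrow> ?Q x0 \<le> ?Q x"
    using continuous_attains_inf[OF compact_sphere, of 0 1 ?Q] by auto
  have "?Q x0 * (norm x)\<^sup>2 \<le> ?Q x" for x
  proof (cases "x = 0")
    case False
    then have "?Q x0 \<le> ?Q ((1 / norm x) *\<^sub>R x)"
      by (intro x0(2)) simp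
    also have "\<dots> = ?Q x / (norm x)\<^sup>2"
      by (simp add: matrix_vector_mult_scaleR power2_eq_square)
    finally show ?thesis using False by (simp add: field_simps)
  qed simp
  moreover have "?Q x0 > 0"
    using x0(1) by (intro pos_def_matrix_inv_pos[OF assms]) auto
  ultimately show ?thesis using that by blast
qed

text \<open>
  The function is a product of one-dimensional normal densities, up to a constant factor.
\<close>

lemma integrable_exp_neg_norm_square:
  fixes k :: real
  assumes "k > 0"
  shows "integrable lborel (\<lambda>x :: real ^ 'd. exp (- k * (norm x)\<^sup>2))"
proof (rule integrableI_nonneg)
  have one: "(\<integral>\<^sup>+t. ennreal (exp (- k * t\<^sup>2)) \<partial>lborel) < \<infinity>"
  proof -
    define \<sigma> where "\<sigma> = sqrt (1 / (2 * k))"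
    have \<sigma>: "\<sigma> > 0" "\<sigma>\<^sup>2 = 1 / (2 * k)" using assms by (auto simp: \<sigma>_def)
    have "(\<lambda>t. exp (- k * t\<^sup>2)) = (\<lambda>t. sqrt (2 * pi * \<sigma>\<^sup>2) * normal_density 0 \<sigma> t)"
      using assms by (auto simp: normal_density_def \<sigma>(2) fun_eq_iff)
    then have "integrable lborel (\<lambda>t. exp (- k * t\<^sup>2))"
      using \<sigma> by simp
    from nn_integral_eq_integral[OF this] show ?thesis by simp
  qed
  have "(\<integral>\<^sup>+x. ennreal (exp (- k * (norm (x :: real ^ 'd))\<^sup>2)) \<partial>lborel) =
      (\<integral>\<^sup>+x. (\<Prod>b\<in>Basis. ennreal (exp (- k * (x \<bullet> (b :: real ^ 'd))\<^sup>2))) \<partial>lborel)"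
  proof (rule nn_integral_cong)
    fix x :: "real ^ 'd"
    have "(norm x)\<^sup>2 = (\<Sum>b\<in>Basis. (x \<bullet> b)\<^sup>2)"
      unfolding power2_norm_eq_inner unfolding power2_eq_square by (rule euclidean_inner)
    then have "exp (- k * (norm x)\<^sup>2) = (\<Prod>b\<in>Basis. exp (- k * (x \<bullet> b)\<^sup>2))"
      by (simp add: sum_distrib_left exp_sum sum_negf[symmetric])
    then show "ennreal (exp (- k * (norm x)\<^sup>2)) = (\<Prod>b\<in>Basis. ennreal (exp (- k * (x \<bullet> b)\<^sup>2)))"
      by (simp add: prod_ennreal)
  qed
  also have "\<dots> = (\<Prod>b\<in>(Basis :: (real ^ 'd) set). (\<integral>\<^sup>+t. ennreal (exp (- k * t\<^sup>2)) \<partial>lborel))"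
    by (rule nn_integral_lborel_prod) auto
  also have "\<dots> < \<infinity>"
    using one by (auto simp: ennreal_prod_eq_top power_less_top_ennreal)
  finally show "(\<integral>\<^sup>+x. ennreal (exp (- k * (norm (x :: real ^ 'd))\<^sup>2)) \<partial>lborel) < \<infinity>" .
qed auto

lemma gaussian_normalizer_pos:
  fixes S :: "real ^ 'd ^ 'd"
  assumes "pos_def S"
  shows "sqrt ((2 * pi) ^ CARD('d) * det S) > 0"
  using pos_def_det_pos[OF assms] by simp

lemma gaussian_density_pos:
  assumes "pos_def S"
  shows "gaussian_density m S x > 0"
  unfolding gaussian_density_def
  by (rule divide_pos_pos[OF exp_gt_zero gaussian_normalizer_pos[OF assms]])

lemma continuous_on_gaussian_density:
  fixes S :: "real ^ 'd ^ 'd"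
  assumes "pos_def S"
  shows "continuous_on A (gaussian_density m S)"
proof -
  have "continuous_on A (\<lambda>x. matrix_inv S *v (x - m))"
    by (rule continuous_on_compose2[OF matrix_vector_mult_linear_continuous_on[of UNIV]])
       (auto intro: continuous_intros)
  then show ?thesis
    unfolding gaussian_density_def[abs_def]
    using gaussian_normalizer_pos[OF assms] by (intro continuous_intros) auto
qed

text \<open>
  A bound centred at the origin, irrespective of the mean, is convenient for the integrability proofs:
  \<open>(norm x)\<^sup>2 \<le> 2 * (norm (x - m))\<^sup>2 + 2 * (norm m)\<^sup>2\<close> moves the centre and halves the rate.
\<close>

lemma gaussian_density_le:
  fixes S :: "real ^ 'd ^ 'd"
  assumes "pos_def S"
  obtains K k where "K > 0" "k > 0" "\<And>x. gaussian_density m S x \<le> K * exp (- k * (norm x)\<^sup>2)"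
proof -
  define Z where "Z = sqrt ((2 * pi) ^ CARD('d) * det S)"
  have Z: "Z > 0" using gaussian_normalizer_pos[OF assms] by (simp add: Z_def)
  obtain \<kappa> where \<kappa>: "\<kappa> > 0" "\<And>x. \<kappa> * (norm x)\<^sup>2 \<le> x \<bullet> (matrix_inv S *v x)"
    using pos_def_matrix_inv_lower_bound[OF assms] by blast
  have "gaussian_density m S x \<le> (exp (\<kappa> / 2 * (norm m)\<^sup>2) / Z) * exp (- (\<kappa> / 4) * (norm x)\<^sup>2)" for x
  proof -
    have "norm x \<le> norm (x - m) + norm m" by norm
    then have "(norm x)\<^sup>2 \<le> (norm (x - m) + norm m)\<^sup>2" by (intro power_mono) auto
    also have "\<dots> \<le> 2 * (norm (x - m))\<^sup>2 + 2 * (norm m)\<^sup>2"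
      using sum_squares_bound[of "norm (x - m)" "norm m"] by (simp add: power2_sum)
    finally have "\<kappa> * (norm x)\<^sup>2 \<le> \<kappa> * (2 * (norm (x - m))\<^sup>2 + 2 * (norm m)\<^sup>2)"
      using \<kappa>(1) by simp
    with \<kappa>(2)[of "x - m"]
    have "- ((x - m) \<bullet> (matrix_inv S *v (x - m))) / 2 \<le> \<kappa> / 2 * (norm m)\<^sup>2 + (- (\<kappa> / 4) * (norm x)\<^sup>2)"
      unfolding distrib_left by linarith
    then have "exp (- ((x - m) \<bullet> (matrix_inv S *v (x - m))) / 2) / Z \<le>
        exp (\<kappa> / 2 * (norm m)\<^sup>2 + (- (\<kappa> / 4) * (norm x)\<^sup>2)) / Z"
      using Z by (intro divide_right_mono) auto
    then show ?thesis
      unfolding gaussian_density_def Z_def[symmetric] exp_add by simp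
  qed
  moreover have "exp (\<kappa> / 2 * (norm m)\<^sup>2) / Z > 0" "\<kappa> / 4 > 0" using Z \<kappa> by auto
  ultimately show ?thesis using that by blast
qed

lemma integrable_gaussian_density_powr:
  fixes S :: "real ^ 'd ^ 'd"
  assumes "pos_def S" "p > 0"
  shows "integrable lborel (\<lambda>x. gaussian_density m S x powr p)"
proof -
  obtain K k where K: "K > 0" "k > 0" "\<And>x. gaussian_density m S x \<le> K * exp (- k * (norm x)\<^sup>2)"
    using gaussian_density_le[OF assms(1)] by blast
  have [measurable]: "gaussian_density m S \<in> borel_measurable borel"
    using continuous_on_gaussian_density[OF assms(1)] by (rule borel_measurable_continuous_onI)
  show ?thesis
  proof (rule Bochner_Integration.integrable_bound)
    show "integrable lborel (\<lambda>x :: real ^ 'd. K powr p * exp (- (k * p) * (norm x)\<^sup>2))"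
      using assms K by (intro integrable_mult_right integrable_exp_neg_norm_square) auto
    show "AE x in lborel. norm (gaussian_density m S x powr p) \<le> norm (K powr p * exp (- (k * p) * (norm x)\<^sup>2))"
    proof (rule AE_I2)
      fix x
      have "gaussian_density m S x powr p \<le> (K * exp (- k * (norm x)\<^sup>2)) powr p"
        using K(3) gaussian_density_pos[OF assms(1), of m x] assms(2) by (intro powr_mono2) auto
      also have "\<dots> = K powr p * exp (- (k * p) * (norm x)\<^sup>2)"
        by (simp add: powr_mult exp_powr_real mult_ac)
      finally show "norm (gaussian_density m S x powr p) \<le> norm (K powr p * exp (- (k * p) * (norm x)\<^sup>2))"
        by simp
    qed
  qed measurable
qed

text \<open>
  The distance to \<open>\<alpha>\<close> grows at most linearly, so its \<open>r\<close>-th power is at most exponential in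
  \<open>norm x\<close>. Half of the decay rate of the density absorbs it.
\<close>

lemma integrable_gaussian_density_set_dist_powr:
  fixes S :: "real ^ 'd ^ 'd"
  assumes "pos_def S" "is_norm N" "r > 0" "finite \<alpha>" "\<alpha> \<noteq> {}"
  shows "integrable lborel (\<lambda>x. gaussian_density m S x * set_dist N x \<alpha> powr r)"
proof -
  obtain K k where K: "K > 0" "k > 0" "\<And>x. gaussian_density m S x \<le> K * exp (- k * (norm x)\<^sup>2)"
    using gaussian_density_le[OF assms(1)] by blast
  obtain C where C: "C > 0" "\<And>x. N x \<le> C * norm x"
    using is_norm_upper_bound[OF assms(2)] by blast
  obtain a where a: "a \<in> \<alpha>" using assms(5) by blast
  define D where "D = r * C * norm a + (r * C)\<^sup>2 / (2 * k)"
  have [measurable]: "gaussian_density m S \<in> borel_measurable borel"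
    using continuous_on_gaussian_density[OF assms(1)] by (rule borel_measurable_continuous_onI)
  have [measurable]: "(\<lambda>x. set_dist N x \<alpha> powr r) \<in> borel_measurable borel"
    by (rule set_dist_powr_measurable) fact+
  show ?thesis
  proof (rule Bochner_Integration.integrable_bound)
    show "integrable lborel (\<lambda>x :: real ^ 'd. (K * exp D) * exp (- (k / 2) * (norm x)\<^sup>2))"
      using K by (intro integrable_mult_right integrable_exp_neg_norm_square) auto
    show "AE x in lborel. norm (gaussian_density m S x * set_dist N x \<alpha> powr r) \<le>
        norm ((K * exp D) * exp (- (k / 2) * (norm x)\<^sup>2))"
    proof (rule AE_I2)
      fix x :: "real ^ 'd"
      define t where "t = norm x"
      have "set_dist N x \<alpha> \<le> N (x - a)" using assms(4) a by (rule set_dist_le)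
      also have "\<dots> \<le> C * norm (x - a)" by (rule C)
      also have "\<dots> \<le> C * (t + norm a)"
        using C(1) norm_triangle_ineq4[of x a] by (simp add: t_def)
      also have "\<dots> \<le> exp (C * (t + norm a))"
        by (rule order_trans[OF _ exp_ge_add_one_self]) simp
      finally have "set_dist N x \<alpha> powr r \<le> exp (C * (t + norm a)) powr r"
        using assms by (intro powr_mono2 set_dist_nonneg) auto
      also have "\<dots> = exp (r * C * t + r * C * norm a)"
        by (simp add: exp_powr_real algebra_simps)
      also have "\<dots> \<le> exp (k / 2 * t\<^sup>2 + D)"
      proof -
        \<comment> \<open>completing the square absorbs the linear term\<close>
        have "0 \<le> (k * t - r * C)\<^sup>2 / (2 * k)" using K by simp
        also have "\<dots> = k / 2 * t\<^sup>2 - r * C * t + (r * C)\<^sup>2 / (2 * k)"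
          using K by (simp add: power2_diff field_simps power2_eq_square)
        finally show ?thesis by (simp add: D_def)
      qed
      finally have "gaussian_density m S x * set_dist N x \<alpha> powr r \<le>
          (K * exp (- k * t\<^sup>2)) * exp (k / 2 * t\<^sup>2 + D)"
        using K gaussian_density_pos[OF assms(1), of m x] by (intro mult_mono) (auto simp: t_def)
      also have "\<dots> = K * (exp (- k * t\<^sup>2) * exp (k / 2 * t\<^sup>2 + D))" by simp
      also have "exp (- k * t\<^sup>2) * exp (k / 2 * t\<^sup>2 + D) = exp D * exp (- (k / 2) * t\<^sup>2)"
        by (simp add: field_simps flip: exp_add)
      finally show "norm (gaussian_density m S x * set_dist N x \<alpha> powr r) \<le>
        norm ((K * exp D) * exp (- (k / 2) * (norm x)\<^sup>2))"
        using K gaussian_density_pos[OF assms(1), of m x] by (simp add: t_def abs_mult)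
    qed
  qed measurable
qed

section \<open>Dilated quantizers\<close>

text \<open>
  The dilation multiplies the quadratic form in the exponent by \<open>\<theta>\<^sup>2\<close>; only the powers of the
  normalizing factor differ.
\<close>

lemma gaussian_density_powr_dilate:
  fixes S :: "real ^ 'd ^ 'd"
  assumes "pos_def S" "p' * \<theta>\<^sup>2 = p"
  obtains A where "A > 0"
    "\<And>y. gaussian_density m S (m + \<theta> *\<^sub>R (y - m)) powr p' = A * gaussian_density m S y powr p"
proof -
  define Z where "Z = sqrt ((2 * pi) ^ CARD('d) * det S)"
  have Z: "Z > 0" using gaussian_normalizer_pos[OF assms(1)] by (simp add: Z_def)
  have "gaussian_density m S (m + \<theta> *\<^sub>R (y - m)) powr p' = Z powr (p - p') * gaussian_density m S y powr p" for y
  proof -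
    define u where "u = (y - m) \<bullet> (matrix_inv S *v (y - m))"
    have "gaussian_density m S (m + \<theta> *\<^sub>R (y - m)) = exp (- (\<theta>\<^sup>2 * u) / 2) / Z"
      unfolding gaussian_density_def Z_def[symmetric] u_def
      by (simp add: matrix_vector_mult_scaleR power2_eq_square mult.assoc)
    also have "\<dots> powr p' = exp (- (\<theta>\<^sup>2 * u) / 2 * p') / Z powr p'"
      by (simp add: powr_divide exp_powr_real)
    also have "- (\<theta>\<^sup>2 * u) / 2 * p' = - u / 2 * p"
      by (simp flip: assms(2))
    also have "exp (- u / 2 * p) / Z powr p' = Z powr (p - p') * (exp (- u / 2 * p) / Z powr p)"
      using Z by (simp add: powr_diff)
    also have "exp (- u / 2 * p) / Z powr p = (exp (- u / 2) / Z) powr p"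
      by (simp add: powr_divide exp_powr_real)
    also have "exp (- u / 2) / Z = gaussian_density m S y"
      unfolding gaussian_density_def Z_def[symmetric] u_def ..
    finally show ?thesis .
  qed
  moreover have "Z powr (p - p') > 0" using Z by simp
  ultimately show ?thesis using that by blast
qed

lemma emeasure_lborel_frontier_cbox:
  fixes a b :: "'a :: euclidean_space"
  shows "emeasure lborel (frontier (cbox a b)) = 0"
proof -
  have "emeasure lborel (cbox a b - box a b) = emeasure lborel (cbox a b) - emeasure lborel (box a b)"
    using emeasure_lborel_box_finite[of a b] by (intro emeasure_Diff) (auto simp: box_subset_cbox)
  also have "\<dots> = 0"
    by (simp add: emeasure_lborel_box_eq emeasure_lborel_cbox_eq)
  finally show ?thesis by (simp add: frontier_cbox)
qed

lemma card_dilate_Int: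
  assumes "\<theta> \<noteq> 0"
  shows "card (dilate \<theta> m \<alpha> \<inter> B) = card (\<alpha> \<inter> {y. m + \<theta> *\<^sub>R (y - m) \<in> B})"
proof -
  have "dilate \<theta> m \<alpha> \<inter> B = (\<lambda>y. m + \<theta> *\<^sub>R (y - m)) ` (\<alpha> \<inter> {y. m + \<theta> *\<^sub>R (y - m) \<in> B})"
    by (auto simp: dilate_def)
  then show ?thesis
    using assms by (simp add: card_image inj_on_def)
qed

lemma dilate_vimage_cbox:
  fixes m :: "real ^ 'd"
  assumes "\<theta> > 0"
  shows "{y. m + \<theta> *\<^sub>R (y - m) \<in> cbox a b} = cbox (m + (1 / \<theta>) *\<^sub>R (a - m)) (m + (1 / \<theta>) *\<^sub>R (b - m))"
proof -
  have "u \<le> w + \<theta> * (t - w) \<longleftrightarrow> w + 1 / \<theta> * (u - w) \<le> t"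
    "w + \<theta> * (t - w) \<le> u \<longleftrightarrow> t \<le> w + 1 / \<theta> * (u - w)" for u w t :: real
    using pos_divide_le_eq[OF assms, of "u - w" "t - w"] pos_le_divide_eq[OF assms, of "t - w" "u - w"]
    by (auto simp: algebra_simps)
  then show ?thesis by (simp add: set_eq_iff mem_box_cart)
qed

theorem proposition5p2:
  fixes N :: "real ^ 'd \<Rightarrow> real"
    and r s \<theta> :: real
    and m :: "real ^ 'd"
    and \<Sigma> :: "real ^ 'd ^ 'd"
    and f :: "real ^ 'd \<Rightarrow> real"
    and \<alpha> :: "nat \<Rightarrow> (real ^ 'd) set"
  assumes "is_norm N"
    and "r > 0"
    and "s > 0"
    and "pos_def \<Sigma>"
    and "f = gaussian_density m \<Sigma>"
    and "asymp_optimal N r f \<alpha>"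
    and "\<theta> = sqrt ((s + real CARD('d)) / (r + real CARD('d)))"
  shows "\<forall>a b. (\<lambda>n. 1 / real n * real (card (dilate \<theta> m (\<alpha> n) \<inter> cbox a b)))
           \<longlonglongrightarrow>
           1 / (LINT x|lborel. f x powr (real CARD('d) / (real CARD('d) + s))) *
             (LINT x:cbox a b|lborel. f x powr (real CARD('d) / (real CARD('d) + s)))"
proof (intro allI)
  fix a b :: "real ^ 'd"
  define p where "p = real CARD('d) / (real CARD('d) + r)"
  define p' where "p' = real CARD('d) / (real CARD('d) + s)"
  define T where "T = (\<lambda>y. m + \<theta> *\<^sub>R (y - m))"
  define B where "B = {y. T y \<in> cbox a b}"
  have p: "p > 0" "p' > 0" using assms(2,3) by (auto simp: p_def p'_def)
  have \<theta>: "\<theta> > 0" using assms(2,3) by (simp add: assms(7))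
  have "\<theta>\<^sup>2 = (s + real CARD('d)) / (r + real CARD('d))"
    using assms(2,3) by (simp add: assms(7))
  then have p\<theta>: "p' * \<theta>\<^sup>2 = p"
    using assms(2,3) by (simp add: p_def p'_def add.commute)
  obtain A where A: "A > 0" "\<And>y. f (T y) powr p' = A * f y powr p"
    using gaussian_density_powr_dilate[OF assms(4) p\<theta>, of m] unfolding assms(5) T_def by blast
  have f_pos: "f x > 0" for x
    using gaussian_density_pos[OF assms(4)] by (simp add: assms(5))
  have f_cont: "continuous_on UNIV f"
    using continuous_on_gaussian_density[OF assms(4)] by (simp add: assms(5))
  have [measurable]: "f \<in> borel_measurable borel"
    using f_cont by (rule borel_measurable_continuous_onI)
  have g_int: "integrable lborel (\<lambda>x. f x powr p)"
    using integrable_gaussian_density_powr[OF assms(4) p(1)] by (simp add: assms(5))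
  have C_pos: "(LINT x|lborel. f x powr p) > 0"
  proof -
    have "(LINT x|lborel. f x powr p) \<noteq> 0"
    proof
      assume "(LINT x|lborel. f x powr p) = 0"
      then have "AE x in lborel. f x powr p = 0"
        using integral_nonneg_eq_0_iff_AE[OF g_int] by simp
      then have "AE x in (lborel :: (real ^ 'd) measure). False"
        by (rule eventually_mono) (use f_pos in \<open>simp add: less_imp_neq[symmetric]\<close>)
      then show False
        using ae_filter_eq_bot_iff[of "lborel :: (real ^ 'd) measure"] by (simp add: trivial_limit_def)
    qed
    moreover have "(LINT x|lborel. f x powr p) \<ge> 0" by simp
    ultimately show ?thesis by linarith
  qed
  have B_eq: "B = cbox (m + (1 / \<theta>) *\<^sub>R (a - m)) (m + (1 / \<theta>) *\<^sub>R (b - m))"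
    unfolding B_def T_def by (rule dilate_vimage_cbox[OF \<theta>])

  have "(\<lambda>n. real (card (\<alpha> n \<inter> B)) / real n) \<longlonglongrightarrow>
      (LINT x:B|lborel. f x powr p) / (LINT x|lborel. f x powr p)"
    unfolding p_def
  proof (rule empirical_measure_convergence[OF assms(1,2) _ f_cont _ _ _ assms(6)])
    show "\<forall>n\<ge>1. integrable lborel (\<lambda>x. f x * set_dist N x (\<alpha> n) powr r)"
      using assms(6) unfolding asymp_optimal_def quantizer_seq_def assms(5)
      by (auto intro!: integrable_gaussian_density_set_dist_powr[OF assms(4,1,2)])
    show "emeasure lborel (frontier B) = 0"
      unfolding B_eq by (rule emeasure_lborel_frontier_cbox)
  qed (use f_pos g_int C_pos in \<open>auto simp: p_def B_eq less_imp_le\<close>)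
  also have "(\<lambda>n. real (card (\<alpha> n \<inter> B)) / real n) =
      (\<lambda>n. 1 / real n * real (card (dilate \<theta> m (\<alpha> n) \<inter> cbox a b)))"
    using \<theta> by (simp add: card_dilate_Int B_def T_def)
  also have "(LINT x:B|lborel. f x powr p) / (LINT x|lborel. f x powr p) =
      1 / (LINT x|lborel. f x powr p') * (LINT x:cbox a b|lborel. f x powr p')"
  proof -
    have T_eq: "T = (\<lambda>y. (m - \<theta> *\<^sub>R m) + \<theta> *\<^sub>R y)"
      by (auto simp: T_def algebra_simps)
    have subst: "(LINT x|lborel. F x) = \<theta> ^ CARD('d) * (LINT y|lborel. F (T y))"
      if "F \<in> borel_measurable borel" for F :: "real ^ 'd \<Rightarrow> real"
      using lborel_integral_affine[of \<theta> F "m - \<theta> *\<^sub>R m"] that \<theta> by (simp add: T_eq)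
    have "(LINT x|lborel. f x powr p') = (\<theta> ^ CARD('d) * A) * (LINT y|lborel. f y powr p)"
      by (subst subst) (auto simp: A(2))
    moreover have "(LINT x:cbox a b|lborel. f x powr p') = (\<theta> ^ CARD('d) * A) * (LINT y:B|lborel. f y powr p)"
    proof -
      have "(\<lambda>y. indicat_real (cbox a b) (T y) *\<^sub>R f (T y) powr p') =
          (\<lambda>y. A * (indicat_real B y *\<^sub>R f y powr p))"
        by (auto simp: A(2) B_def indicator_def)
      then show ?thesis
        unfolding set_lebesgue_integral_def by (subst subst) auto
    qed
    ultimately show ?thesis
      using \<theta> A(1) by simp
  qed
  finally show "(\<lambda>n. 1 / real n * real (card (dilate \<theta> m (\<alpha> n) \<inter> cbox a b)))
           \<longlonglongrightarrow>
           1 / (LINT x|lborel. f x powr (real CARD('d) / (real CARD('d) + s))) *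
             (LINT x:cbox a b|lborel. f x powr (real CARD('d) / (real CARD('d) + s)))"
    unfolding p'_def .
qed

end
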